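(* Let $K$ be a field, let $\psi\colon D\to E$ be a morphism of dialgebras over $K$, let $N$ be a positive integer, and let $\Theta_t$ be a deformation of order $N$ of $\psi$. Then $\Theta_t$ extends to a deformation of order $N+1$ if and only if the cohomology class of $\mathrm{Ob}(\Theta_t)$ (a $3$-cocycle in $CY^3(\psi,\psi)$) vanishes. More precisely, if $\theta_{N+1}=(F_{D,N+1};F_{E,N+1};\psi_{N+1})\in CY^2(\psi,\psi)$ is a $2$-cochain, then $\bar\Theta_t=\Theta_t+t^{N+1}\theta_{N+1}$ is an order $N+1$ extension of $\Theta_t$ if and only if $\mathrm{Ob}(\Theta_t)=\delta\theta_{N+1}$.
   Context: **Dialgebras.** All tensor products and $\mathrm{Hom}$'s are over the field $K$. A dialgebra over $K$ is a $K$-module $D$ with two $K$-bilinear maps $\dashv,\vdash\colon D\otimes D\to D$ (left and right product) such that for all $x,y,z$: (1) $x\dashv(y\dashv z)=(x\dashv y)\dashv z$; (2) $(x\dashv y)\dashv z=x\dashv(y\vdash z)$; (3) $(x\vdash y)\dashv z=x\vdash(y\dashv z)$; (4) $(x\dashv y)\vdash z=x\vdash(y\vdash z)$; (5) $x\vdash(y\vdash z)=(x\vdash y)\vdash z$. A morphism of dialgebras is a $K$-linear map preserving both products. A representation of $D$ is a $K$-module $M$ with left actions $\dashv,\vdash\colon D\otimes M\to M$ and right actions $\dashv,\vdash\colon M\otimes D\to M$ satisfying the fifteen identities obtained from (1)–(5) by letting exactly one of $x,y,z$ lie in $M$. $D$ is a representation of itself; given a morphism $\psi\colon D\to E$, $E$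 is a representation of $D$ via $a* e=\psi(a)* e$, $e* a=e*\psi(a)$ for $*\in\{\dashv,\vdash\}$. **Trees.** $Y_n$ is the set of planar binary trees with $n+1$ leaves, numbered $0,\dots,n$ from left to right ("$n$-trees"); $Y_0=\{|\}$, and every $y\in Y_n$ with $n\ge1$ is uniquely a grafting $y=y_1\vee y_2$ (left subtree $y_1$, right subtree $y_2$). The two $2$-trees are $[21]=|\vee(|\vee|)$, $[12]=(|\vee|)\vee|$; the five $3$-trees are $[321]=|\vee[21]$, $[312]=|\vee[12]$, $[131]=(|\vee|)\vee(|\vee|)$, $[213]=[21]\vee|$, $[123]=[12]\vee|$. For $y\in Y_n$, $n\ge1$, $d_iy\in Y_{n-1}$ is obtained by deleting the $i$th leaf. For $y\in Y_{n+1}$ define $\circ^y_i\in\{\dashv,\vdash\}$, $0\le i\le n+1$: $\circ^y_0=\dashv$ if $y=|\vee y_1$ for some $y_1$, and $\vdash$ otherwise; for $1\le i\le n$, $\circ^y_i=\dashv$ if the $i$th leaf is the left branch at its vertex, and $\vdash$ if it is the right branch; $\circ^y_{n+1}=\vdash$ if $y=y_1\vee|$ for some $y_1$, and $\dashv$ otherwise. **Dialgebra cochains.** For a representation $M$ of $D$, $CY^n(D,M)=\mathrm{Hom}(K[Y_n]\otimes D^{\otimes n},M)$ for $n\ge0$, and $\delta=\sum_{i=0}^{n+1}(-1)^i\delta^i\colon CY^n(D,M)\to CY^{n+1}(D,M)$, where $(\delta^if)(y\otimes(a_1,\dots,a_{n+1}))$ equals $a_1\circ^y_0f(d_0y\otimes(a_2,\dots,a_{n+1}))$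 if $i=0$; $f(d_iy\otimes(\dots,a_{i-1},a_i\circ^y_ia_{i+1},a_{i+2},\dots))$ if $1\le i\le n$; and $f(d_{n+1}y\otimes(a_1,\dots,a_n))\circ^y_{n+1}a_{n+1}$ if $i=n+1$. **Deformation complex.** For $n\ge1$ put $CY^n(\psi,\psi)=CY^n(D,D)\times CY^n(E,E)\times CY^{n-1}(D,E)$ and $\delta(\xi;\pi;\varphi)=(\delta\xi;\ \delta\pi;\ \psi\xi-\pi\psi-\delta\varphi)\in CY^{n+1}(\psi,\psi)$, where $(\psi\xi)(y\otimes(a_1,\dots,a_n))=\psi(\xi(y\otimes(a_1,\dots,a_n)))$ and $(\pi\psi)(y\otimes(a_1,\dots,a_n))=\pi(y\otimes(\psi(a_1),\dots,\psi(a_n)))$. This is a cochain complex; the cohomology class of a $3$-cocycle is its class in $HY^3(\psi,\psi)=H^3(CY^*(\psi,\psi),\delta)$. **Deformations of order $N$.** A pair $(F^l;F^r)$ of $K$-bilinear maps $D\otimes D\to D$ is identified with $F\in CY^2(D,D)$, $F([21]\otimes(a,b))=F^l(a,b)$, $F([12]\otimes(a,b))=F^r(a,b)$; a $K$-linear map $D\to E$ is identified with an element of $CY^1(D,E)$. A deformation of order $N$ of $\psi$ is a triple $\Theta_t=(f_{D,t};f_{E,t};\Psi_t)=\sum_{i=0}^N\theta_it^i$, $\theta_i=(F_{D,i};F_{E,i};\psi_i)\in CY^2(\psi,\psi)$, with $f_{D,t}=\sum_{i=0}^NF_{D,i}t^i$, $f_{E,t}=\sum_{i=0}^NF_{E,i}t^i$,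 $\Psi_t=\sum_{i=0}^N\psi_it^i$, such that: $F^l_{D,0},F^r_{D,0}$ (resp. $F^l_{E,0},F^r_{E,0}$) are the products $\dashv,\vdash$ of $D$ (resp. $E$) and $\psi_0=\psi$; the products $f^l_{D,t},f^r_{D,t}$ satisfy the five dialgebra axioms modulo $t^{N+1}$, and likewise $f^l_{E,t},f^r_{E,t}$; and $\sum_{i=0}^n\psi_iF^*_{D,n-i}(a,b)=\sum_{i+j+k=n,\ i,j,k\ge0}F^*_{E,i}(\psi_j(a),\psi_k(b))$ for all $a,b\in D$, $0\le n\le N$, $*\in\{l,r\}$. $\Theta_t$ extends to order $N+1$ iff there is a $2$-cochain $\theta_{N+1}\in CY^2(\psi,\psi)$ such that $\bar\Theta_t=\Theta_t+t^{N+1}\theta_{N+1}$ is a deformation of order $N+1$; such a $\bar\Theta_t$ is called an order $N+1$ extension of $\Theta_t$. **Obstruction class.** For $F,G\in CY^2(D,D)$ the pre-Lie product $F\circ G\in CY^3(D,D)$ takes the following values on $y\otimes(a,b,c)$: for $y=[321]$: $F^l(G^l(a,b),c)-F^l(a,G^l(b,c))$; for $y=[312]$: $F^l(G^l(a,b),c)-F^l(a,G^r(b,c))$; for $y=[131]$: $F^l(G^r(a,b),c)-F^r(a,G^l(b,c))$; for $y=[213]$: $F^r(G^l(a,b),c)-F^r(a,G^r(b,c))$; for $y=[123]$: $F^r(G^r(a,b),c)-F^r(a,G^r(b,c))$; similarly for $E$. For $\Theta_t$ of order $N$, $\mathrm{Ob}(\Theta_t)=(\mathrm{Ob}_D;\mathrm{Ob}_E;\mathrm{Ob}_\psi)\in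 CY^3(\psi,\psi)$, where $\mathrm{Ob}_D=\sum_{i+j=N+1,\ i,j>0}F_{D,i}\circ F_{D,j}$, $\mathrm{Ob}_E=\sum_{i+j=N+1,\ i,j>0}F_{E,i}\circ F_{E,j}$, and $\mathrm{Ob}_\psi\in CY^2(D,E)$ is $\mathrm{Ob}_\psi([21]\otimes(a,b))=\sum'F^l_{E,i}(\psi_j(a),\psi_k(b))-\sum_{i=1}^N\psi_iF^l_{D,N+1-i}(a,b)$ and $\mathrm{Ob}_\psi([12]\otimes(a,b))=\sum'F^r_{E,i}(\psi_j(a),\psi_k(b))-\sum_{i=1}^N\psi_iF^r_{D,N+1-i}(a,b)$, with $\sum'$ the sum over all integer triples $(i,j,k)$ with $0\le i,j,k\le N$ and $i+j+k=N+1$. *)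

theory Defs
  imports Complex_Main "HOL-Library.Function_Algebras" "HOL-Library.Product_Plus"
begin

section \<open>Dialgebras\<close>

text \<open>The two products are one family indexed by \<open>side\<close>: \<open>p Lft\<close> is the left product
  \<open>\<stileturn>\<close> and \<open>p Rgt\<close> the right product \<open>\<turnstile>\<close>.\<close>

datatype side = Lft | Rgt

text \<open>The five axioms are stated up to a relation \<open>eq\<close>, so that the same formula serves for
  dialgebras (equality) and for deformations (equality modulo a power of \<open>t\<close>).\<close>

definition dialgebra_laws :: "('a \<Rightarrow> 'a \<Rightarrow> bool) \<Rightarrow> (side \<Rightarrow> 'a \<Rightarrow> 'a \<Rightarrow> 'a) \<Rightarrow> bool" where
  "dialgebra_laws eq p \<longleftrightarrow> (\<forall>x y z.
     eq (p Lft x (p Lft y z)) (p Lft (p Lft x y) z) \<and>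
     eq (p Lft (p Lft x y) z) (p Lft x (p Rgt y z)) \<and>
     eq (p Lft (p Rgt x y) z) (p Rgt x (p Lft y z)) \<and>
     eq (p Rgt (p Lft x y) z) (p Rgt x (p Rgt y z)) \<and>
     eq (p Rgt x (p Rgt y z)) (p Rgt (p Rgt x y) z))"

definition dialgebra ::
  "('k::field \<Rightarrow> 'd::ab_group_add \<Rightarrow> 'd) \<Rightarrow> (side \<Rightarrow> 'd \<Rightarrow> 'd \<Rightarrow> 'd) \<Rightarrow> bool" where
  "dialgebra sD pD \<longleftrightarrow> vector_space sD \<and>
     (\<forall>s a. Vector_Spaces.linear sD sD (\<lambda>b. pD s a b)) \<and>
     (\<forall>s b. Vector_Spaces.linear sD sD (\<lambda>a. pD s a b)) \<and>
     dialgebra_laws (=) pD"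

definition dialgebra_hom ::
  "('k::field \<Rightarrow> 'd::ab_group_add \<Rightarrow> 'd) \<Rightarrow> (side \<Rightarrow> 'd \<Rightarrow> 'd \<Rightarrow> 'd) \<Rightarrow>
   ('k \<Rightarrow> 'e::ab_group_add \<Rightarrow> 'e) \<Rightarrow> (side \<Rightarrow> 'e \<Rightarrow> 'e \<Rightarrow> 'e) \<Rightarrow> ('d \<Rightarrow> 'e) \<Rightarrow> bool" where
  "dialgebra_hom sD pD sE pE \<psi> \<longleftrightarrow> Vector_Spaces.linear sD sE \<psi> \<and>
     (\<forall>s a b. \<psi> (pD s a b) = pE s (\<psi> a) (\<psi> b))"


section \<open>Planar binary trees\<close>

datatype pbtree = Leaf | Graft pbtree pbtree

fun leaves :: "pbtree \<Rightarrow> nat" where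
  "leaves Leaf = 1"
| "leaves (Graft u v) = leaves u + leaves v"

definition Y :: "nat \<Rightarrow> pbtree set" where
  "Y n = {y. leaves y = n + 1}"

definition "t1 = Graft Leaf Leaf"
definition "t21 = Graft Leaf t1"
definition "t12 = Graft t1 Leaf"
definition "t321 = Graft Leaf t21"
definition "t312 = Graft Leaf t12"
definition "t131 = Graft t1 t1"
definition "t213 = Graft t21 Leaf"
definition "t123 = Graft t12 Leaf"

text \<open>\<open>del i y\<close> deletes the \<open>i\<close>th leaf of \<open>y\<close> (leaves are numbered from 0, left to right)
  together with its vertex. The value on \<open>Leaf\<close> is a dummy.\<close>

fun del :: "nat \<Rightarrow> pbtree \<Rightarrow> pbtree" where
  "del i Leaf = Leaf"
| "del i (Graft u v) =
     (if i < leaves u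
      then (if u = Leaf then v else Graft (del i u) v)
      else (if v = Leaf then u else Graft u (del (i - leaves u) v)))"

text \<open>\<open>left_leaf i y\<close>: the \<open>i\<close>th leaf is the left branch at the vertex it is attached to.
  The value on \<open>Leaf\<close> is a dummy.\<close>

fun left_leaf :: "nat \<Rightarrow> pbtree \<Rightarrow> bool" where
  "left_leaf i Leaf \<longleftrightarrow> False"
| "left_leaf i (Graft u v) \<longleftrightarrow>
     (if i < leaves u then u = Leaf \<or> left_leaf i u
      else v \<noteq> Leaf \<and> left_leaf (i - leaves u) v)"

text \<open>For \<open>y\<close> in \<open>Y (n + 1)\<close> the index of the last leaf is \<open>n + 1 = leaves y - 1\<close>.\<close>

definition circ :: "pbtree \<Rightarrow> nat \<Rightarrow> side" where
  "circ y i =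
     (if i = 0 then (if \<exists>v. y = Graft Leaf v then Lft else Rgt)
      else if i = leaves y - 1 then (if \<exists>u. y = Graft u Leaf then Rgt else Lft)
      else (if left_leaf i y then Lft else Rgt))"


section \<open>Dialgebra cochains\<close>

text \<open>A linear map from the tensor product of \<open>K[Y\<^sub>n]\<close> with the \<open>n\<close>th tensor power of \<open>D\<close>
  to \<open>M\<close> is given by its values on \<open>y \<otimes> (a\<^sub>1, \<dots>, a\<^sub>n)\<close>: one \<open>n\<close>-linear map for each tree \<open>y\<close> in
  \<open>Y n\<close>. The arguments are passed as a list, and the function is 0 outside its domain so that
  equality of cochains is equality of functions.\<close>

type_synonym ('d, 'm) cochain = "pbtree \<Rightarrow> 'd list \<Rightarrow> 'm"

definition CY ::
  "('k::field \<Rightarrow> 'd::ab_group_add \<Rightarrow> 'd) \<Rightarrow> ('k \<Rightarrow> 'm::ab_group_add \<Rightarrow> 'm) \<Rightarrow> nat \<Rightarrow>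
   ('d, 'm) cochain set" where
  "CY sD sM n = {f.
     (\<forall>y\<in>Y n. \<forall>xs i. length xs = n \<longrightarrow> i < n \<longrightarrow>
        Vector_Spaces.linear sD sM (\<lambda>x. f y (xs[i := x]))) \<and>
     (\<forall>y xs. \<not> (y \<in> Y n \<and> length xs = n) \<longrightarrow> f y xs = 0)}"

text \<open>The coboundary. The representation \<open>M\<close> enters only through its left actions
  \<open>la s a m\<close> and right actions \<open>ra s m a\<close>; its axioms play no role in the formula. The list \<open>xs = [a\<^sub>1, \<dots>, a\<^bsub>n+1\<^esub>]\<close> is indexed from 0,
  so \<open>a\<^sub>i\<close> is \<open>xs ! (i - 1)\<close>.\<close>

definition face ::
  "(side \<Rightarrow> 'd \<Rightarrow> 'd \<Rightarrow> 'd) \<Rightarrow> (side \<Rightarrow> 'd \<Rightarrow> 'm \<Rightarrow> 'm) \<Rightarrow> (side \<Rightarrow> 'm \<Rightarrow> 'd \<Rightarrow> 'm) \<Rightarrow>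
   nat \<Rightarrow> nat \<Rightarrow> ('d, 'm) cochain \<Rightarrow> ('d, 'm) cochain" where
  "face pD la ra n i f y xs =
     (if i = 0 then la (circ y 0) (hd xs) (f (del 0 y) (tl xs))
      else if i = n + 1 then ra (circ y i) (f (del i y) (butlast xs)) (last xs)
      else f (del i y)
             (take (i - 1) xs @ [pD (circ y i) (xs ! (i - 1)) (xs ! i)] @ drop (i + 1) xs))"

definition coboundary ::
  "(side \<Rightarrow> 'd \<Rightarrow> 'd \<Rightarrow> 'd) \<Rightarrow> (side \<Rightarrow> 'd \<Rightarrow> 'm \<Rightarrow> 'm) \<Rightarrow> (side \<Rightarrow> 'm \<Rightarrow> 'd \<Rightarrow> 'm) \<Rightarrow>
   nat \<Rightarrow> ('d, 'm::ab_group_add) cochain \<Rightarrow> ('d, 'm) cochain" where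
  "coboundary pD la ra n f y xs =
     (if y \<in> Y (n + 1) \<and> length xs = n + 1
      then \<Sum>i\<le>n + 1. if even i then face pD la ra n i f y xs else - face pD la ra n i f y xs
      else 0)"


section \<open>The deformation complex of a morphism\<close>

type_synonym ('d, 'e) mcochain = "('d, 'd) cochain \<times> ('e, 'e) cochain \<times> ('d, 'e) cochain"

definition CYm ::
  "('k::field \<Rightarrow> 'd::ab_group_add \<Rightarrow> 'd) \<Rightarrow> ('k \<Rightarrow> 'e::ab_group_add \<Rightarrow> 'e) \<Rightarrow> nat \<Rightarrow>
   ('d, 'e) mcochain set" where
  "CYm sD sE n = CY sD sD n \<times> CY sE sE n \<times> CY sD sE (n - 1)"

text \<open>Here \<open>E\<close> is a representation of \<open>D\<close> via \<open>\<psi>\<close>.\<close>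

definition dm ::
  "(side \<Rightarrow> 'd \<Rightarrow> 'd \<Rightarrow> 'd) \<Rightarrow> (side \<Rightarrow> 'e \<Rightarrow> 'e \<Rightarrow> 'e) \<Rightarrow> ('d \<Rightarrow> 'e) \<Rightarrow> nat \<Rightarrow>
   ('d::ab_group_add, 'e::ab_group_add) mcochain \<Rightarrow> ('d, 'e) mcochain" where
  "dm pD pE \<psi> n = (\<lambda>(\<xi>, \<pi>, \<phi>).
     (coboundary pD pD pD n \<xi>,
      coboundary pE pE pE n \<pi>,
      \<lambda>y xs. \<psi> (\<xi> y xs) - \<pi> y (map \<psi> xs) -
        coboundary pD (\<lambda>s a e. pE s (\<psi> a) e) (\<lambda>s e a. pE s e (\<psi> a)) (n - 1) \<phi> y xs))"

definition cocycles ::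
  "('k::field \<Rightarrow> 'd::ab_group_add \<Rightarrow> 'd) \<Rightarrow> (side \<Rightarrow> 'd \<Rightarrow> 'd \<Rightarrow> 'd) \<Rightarrow>
   ('k \<Rightarrow> 'e::ab_group_add \<Rightarrow> 'e) \<Rightarrow> (side \<Rightarrow> 'e \<Rightarrow> 'e \<Rightarrow> 'e) \<Rightarrow> ('d \<Rightarrow> 'e) \<Rightarrow> nat \<Rightarrow>
   ('d, 'e) mcochain set" where
  "cocycles sD pD sE pE \<psi> n = {z \<in> CYm sD sE n. dm pD pE \<psi> n z = 0}"

text \<open>The complex starts in degree 1, so there are no nonzero coboundaries in degree 1.\<close>

definition coboundaries ::
  "('k::field \<Rightarrow> 'd::ab_group_add \<Rightarrow> 'd) \<Rightarrow> (side \<Rightarrow> 'd \<Rightarrow> 'd \<Rightarrow> 'd) \<Rightarrow>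
   ('k \<Rightarrow> 'e::ab_group_add \<Rightarrow> 'e) \<Rightarrow> (side \<Rightarrow> 'e \<Rightarrow> 'e \<Rightarrow> 'e) \<Rightarrow> ('d \<Rightarrow> 'e) \<Rightarrow> nat \<Rightarrow>
   ('d, 'e) mcochain set" where
  "coboundaries sD pD sE pE \<psi> n =
     (if n \<le> 1 then {0} else dm pD pE \<psi> (n - 1) ` CYm sD sE (n - 1))"

definition cohomologous ::
  "('k::field \<Rightarrow> 'd::ab_group_add \<Rightarrow> 'd) \<Rightarrow> (side \<Rightarrow> 'd \<Rightarrow> 'd \<Rightarrow> 'd) \<Rightarrow>
   ('k \<Rightarrow> 'e::ab_group_add \<Rightarrow> 'e) \<Rightarrow> (side \<Rightarrow> 'e \<Rightarrow> 'e \<Rightarrow> 'e) \<Rightarrow> ('d \<Rightarrow> 'e) \<Rightarrow> nat \<Rightarrow>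
   (('d, 'e) mcochain \<times> ('d, 'e) mcochain) set" where
  "cohomologous sD pD sE pE \<psi> n =
     {(z, w). z \<in> cocycles sD pD sE pE \<psi> n \<and> w \<in> cocycles sD pD sE pE \<psi> n \<and>
              z - w \<in> coboundaries sD pD sE pE \<psi> n}"

text \<open>Elements of the quotient \<open>HY\<^sup>n(\<psi>, \<psi>) = cocycles // cohomologous\<close>; the zero element is the
  class of the zero cochain.\<close>

definition HY_class ::
  "('k::field \<Rightarrow> 'd::ab_group_add \<Rightarrow> 'd) \<Rightarrow> (side \<Rightarrow> 'd \<Rightarrow> 'd \<Rightarrow> 'd) \<Rightarrow>
   ('k \<Rightarrow> 'e::ab_group_add \<Rightarrow> 'e) \<Rightarrow> (side \<Rightarrow> 'e \<Rightarrow> 'e \<Rightarrow> 'e) \<Rightarrow> ('d \<Rightarrow> 'e) \<Rightarrow> nat \<Rightarrow>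
   ('d, 'e) mcochain \<Rightarrow> ('d, 'e) mcochain set" where
  "HY_class sD pD sE pE \<psi> n z = cohomologous sD pD sE pE \<psi> n `` {z}"


section \<open>Deformations of finite order\<close>

text \<open>A 2-cochain \<open>F\<close> is identified with the pair \<open>(bil F Lft; bil F Rgt)\<close> of bilinear maps, and
  a 1-cochain \<open>\<phi>\<close> with the linear map \<open>lin \<phi>\<close>.\<close>

fun tree_of :: "side \<Rightarrow> pbtree" where
  "tree_of Lft = t21"
| "tree_of Rgt = t12"

definition bil :: "('d, 'm) cochain \<Rightarrow> side \<Rightarrow> 'd \<Rightarrow> 'd \<Rightarrow> 'm" where
  "bil F s a b = F (tree_of s) [a, b]"

definition lin :: "('d, 'm) cochain \<Rightarrow> 'd \<Rightarrow> 'm" where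
  "lin \<phi> a = \<phi> t1 [a]"

text \<open>A power series in \<open>t\<close> with coefficients in \<open>D\<close> is its coefficient sequence \<open>nat \<Rightarrow> 'd\<close>.
  \<open>tprod N F\<close> is the \<open>K[[t]]\<close>-bilinear extension to \<open>D[[t]]\<close> of \<open>F\<^sub>0 + F\<^sub>1 t + \<dots> + F\<^sub>N t\<^sup>N\<close>, and
  \<open>eq_mod N\<close> is equality modulo \<open>t\<^bsup>N+1\<^esup>\<close>.\<close>

definition tprod ::
  "nat \<Rightarrow> (nat \<Rightarrow> ('d, 'd) cochain) \<Rightarrow> side \<Rightarrow> (nat \<Rightarrow> 'd) \<Rightarrow> (nat \<Rightarrow> 'd) \<Rightarrow> nat \<Rightarrow> 'd::ab_group_add"
  where
  "tprod N F s u v = (\<lambda>n. \<Sum>(i, j, k) \<in> {(i, j, k). i \<le> N \<and> i + j + k = n}. bil (F i) s (u j) (v k))"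

definition eq_mod :: "nat \<Rightarrow> (nat \<Rightarrow> 'd) \<Rightarrow> (nat \<Rightarrow> 'd) \<Rightarrow> bool" where
  "eq_mod N u v \<longleftrightarrow> (\<forall>n\<le>N. u n = v n)"

text \<open>The coefficients \<open>\<theta>\<^sub>i = (F\<^bsub>D,i\<^esub>; F\<^bsub>E,i\<^esub>; \<psi>\<^sub>i)\<close> of \<open>\<Theta>\<close> are given by a sequence of which only the
  terms with index at most \<open>N\<close> matter for a deformation of order \<open>N\<close>.\<close>

definition FD :: "(nat \<Rightarrow> ('d, 'e) mcochain) \<Rightarrow> nat \<Rightarrow> ('d, 'd) cochain" where
  "FD \<Theta> i = fst (\<Theta> i)"

definition FE :: "(nat \<Rightarrow> ('d, 'e) mcochain) \<Rightarrow> nat \<Rightarrow> ('e, 'e) cochain" where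
  "FE \<Theta> i = fst (snd (\<Theta> i))"

definition Fpsi :: "(nat \<Rightarrow> ('d, 'e) mcochain) \<Rightarrow> nat \<Rightarrow> 'd \<Rightarrow> 'e" where
  "Fpsi \<Theta> i = lin (snd (snd (\<Theta> i)))"

definition deformation ::
  "('k::field \<Rightarrow> 'd::ab_group_add \<Rightarrow> 'd) \<Rightarrow> (side \<Rightarrow> 'd \<Rightarrow> 'd \<Rightarrow> 'd) \<Rightarrow>
   ('k \<Rightarrow> 'e::ab_group_add \<Rightarrow> 'e) \<Rightarrow> (side \<Rightarrow> 'e \<Rightarrow> 'e \<Rightarrow> 'e) \<Rightarrow> ('d \<Rightarrow> 'e) \<Rightarrow> nat \<Rightarrow>
   (nat \<Rightarrow> ('d, 'e) mcochain) \<Rightarrow> bool" where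
  "deformation sD pD sE pE \<psi> N \<Theta> \<longleftrightarrow>
     (\<forall>i\<le>N. \<Theta> i \<in> CYm sD sE 2) \<and>
     bil (FD \<Theta> 0) = pD \<and> bil (FE \<Theta> 0) = pE \<and> Fpsi \<Theta> 0 = \<psi> \<and>
     dialgebra_laws (eq_mod N) (tprod N (FD \<Theta>)) \<and>
     dialgebra_laws (eq_mod N) (tprod N (FE \<Theta>)) \<and>
     (\<forall>s a b. \<forall>n\<le>N.
        (\<Sum>i\<le>n. Fpsi \<Theta> i (bil (FD \<Theta> (n - i)) s a b)) =
        (\<Sum>(i, j, k) \<in> {(i, j, k). i + j + k = n}. bil (FE \<Theta> i) s (Fpsi \<Theta> j a) (Fpsi \<Theta> k b)))"

text \<open>\<open>\<theta>'\<close> is the coefficient of \<open>t\<^bsup>N+1\<^esup>\<close> in an order \<open>N + 1\<close> extension of \<open>\<Theta>\<close>.\<close>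

definition extension ::
  "('k::field \<Rightarrow> 'd::ab_group_add \<Rightarrow> 'd) \<Rightarrow> (side \<Rightarrow> 'd \<Rightarrow> 'd \<Rightarrow> 'd) \<Rightarrow>
   ('k \<Rightarrow> 'e::ab_group_add \<Rightarrow> 'e) \<Rightarrow> (side \<Rightarrow> 'e \<Rightarrow> 'e \<Rightarrow> 'e) \<Rightarrow> ('d \<Rightarrow> 'e) \<Rightarrow> nat \<Rightarrow>
   (nat \<Rightarrow> ('d, 'e) mcochain) \<Rightarrow> ('d, 'e) mcochain \<Rightarrow> bool" where
  "extension sD pD sE pE \<psi> N \<Theta> \<theta>' \<longleftrightarrow>
     deformation sD pD sE pE \<psi> (N + 1) (\<Theta>(N + 1 := \<theta>'))"


section \<open>The obstruction cochain\<close>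

definition pre_lie ::
  "('d, 'd) cochain \<Rightarrow> ('d, 'd) cochain \<Rightarrow> ('d, 'd::ab_group_add) cochain" where
  "pre_lie F G y xs =
     (case xs of [a, b, c] \<Rightarrow>
        (if y = t321 then bil F Lft (bil G Lft a b) c - bil F Lft a (bil G Lft b c)
         else if y = t312 then bil F Lft (bil G Lft a b) c - bil F Lft a (bil G Rgt b c)
         else if y = t131 then bil F Lft (bil G Rgt a b) c - bil F Rgt a (bil G Lft b c)
         else if y = t213 then bil F Rgt (bil G Lft a b) c - bil F Rgt a (bil G Rgt b c)
         else if y = t123 then bil F Rgt (bil G Rgt a b) c - bil F Rgt a (bil G Rgt b c)
         else 0)
      | _ \<Rightarrow> 0)"

definition Ob_alg :: "nat \<Rightarrow> (nat \<Rightarrow> ('d, 'd) cochain) \<Rightarrow> ('d, 'd::ab_group_add) cochain" where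
  "Ob_alg N F y xs =
     (\<Sum>(i, j) \<in> {(i, j). i + j = N + 1 \<and> i > 0 \<and> j > 0}. pre_lie (F i) (F j) y xs)"

definition Ob_bil ::
  "nat \<Rightarrow> (nat \<Rightarrow> ('d, 'e) mcochain) \<Rightarrow> side \<Rightarrow> 'd \<Rightarrow> 'd \<Rightarrow> 'e::ab_group_add" where
  "Ob_bil N \<Theta> s a b =
     (\<Sum>(i, j, k) \<in> {(i, j, k). i \<le> N \<and> j \<le> N \<and> k \<le> N \<and> i + j + k = N + 1}.
        bil (FE \<Theta> i) s (Fpsi \<Theta> j a) (Fpsi \<Theta> k b)) -
     (\<Sum>i = 1..N. Fpsi \<Theta> i (bil (FD \<Theta> (N + 1 - i)) s a b))"

definition Ob_psi ::
  "nat \<Rightarrow> (nat \<Rightarrow> ('d, 'e) mcochain) \<Rightarrow> ('d, 'e::ab_group_add) cochain" where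
  "Ob_psi N \<Theta> y xs =
     (case xs of [a, b] \<Rightarrow>
        (if y = t21 then Ob_bil N \<Theta> Lft a b
         else if y = t12 then Ob_bil N \<Theta> Rgt a b
         else 0)
      | _ \<Rightarrow> 0)"

definition Ob ::
  "nat \<Rightarrow> (nat \<Rightarrow> ('d::ab_group_add, 'e::ab_group_add) mcochain) \<Rightarrow> ('d, 'e) mcochain" where
  "Ob N \<Theta> = (Ob_alg N (FD \<Theta>), Ob_alg N (FE \<Theta>), Ob_psi N \<Theta>)"

end

theory Submission
  imports Defs
begin

text \<open>The truncated families \<open>F\<^sub>0 + \<dots> + F\<^sub>N t\<^sup>N\<close> define honest products and maps on formal power
  series, which satisfy the laws modulo \<open>t\<^bsup>N+1\<^esup>\<close>. The associators of these products and the failure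
  of multiplicativity of the map are linear over power series, so each of them is determined by its
  values on constants; their coefficients at \<open>t\<^bsup>N+1\<^esup>\<close> on constants are the components of the obstruction.
  For any biadditive products whatsoever, the alternating sum of associators over the five faces of a
  4-tree vanishes identically (a dialgebra pentagon), and similarly for the failure of
  multiplicativity over a 3-tree. Since all lower coefficients vanish, the coefficient of
  \<open>t\<^bsup>N+1\<^esup>\<close> in these identities only involves the undeformed structure, and says that the obstruction
  is a cocycle. Adding a term \<open>\<theta> t\<^bsup>N+1\<^esup>\<close> changes the coefficient of \<open>t\<^bsup>N+1\<^esup>\<close> in the laws by
  minus the coboundary of \<open>\<theta>\<close>.\<close>

section \<open>Planar binary trees and associators\<close>

lemma leaves_pos: "0 < leaves y"
  by (induction y) auto

lemma leaves_eq_1_iff: "leaves y = 1 \<longleftrightarrow> y = Leaf"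
proof (cases y)
  case (Graft u v)
  then show ?thesis using leaves_pos[of u] leaves_pos[of v] by simp
qed simp

lemma Y_0: "Y 0 = {Leaf}"
  using leaves_eq_1_iff by (auto simp: Y_def)

lemma Y_Suc: "Y (Suc n) = (\<Union>i\<le>n. \<Union>u\<in>Y i. Graft u ` Y (n - i))"
proof (intro set_eqI iffI)
  fix y assume y: "y \<in> Y (Suc n)"
  then obtain u v where uv: "y = Graft u v" by (cases y) (auto simp: Y_def)
  then have "leaves u - 1 \<le> n" "u \<in> Y (leaves u - 1)" "v \<in> Y (n - (leaves u - 1))"
    using y leaves_pos[of u] leaves_pos[of v]
    by (simp_all add: Y_def)
  then show "y \<in> (\<Union>i\<le>n. \<Union>u\<in>Y i. Graft u ` Y (n - i))" using uv by blast
next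
  fix y assume "y \<in> (\<Union>i\<le>n. \<Union>u\<in>Y i. Graft u ` Y (n - i))"
  then show "y \<in> Y (Suc n)" by (auto simp: Y_def)
qed

lemma Y_1: "Y 1 = {t1}"
  by (simp add: Y_Suc Y_0 t1_def)

lemma Y_2: "Y 2 = {t21, t12}"
  unfolding numeral_2_eq_2 Y_Suc[of "Suc 0"]
  by (simp add: atMost_Suc Y_0 Y_1[simplified] t21_def t12_def)

lemma Y_3: "Y 3 = {t321, t312, t131, t213, t123}"
  unfolding numeral_3_eq_3 Y_Suc[of "Suc (Suc 0)"]
  by (simp add: atMost_Suc Y_0 Y_1[simplified] Y_2[unfolded numeral_2_eq_2]
      t321_def t312_def t131_def t213_def t123_def numeral_2_eq_2) blast

lemma Y_4: "Y 4 = Graft Leaf ` Y 3 \<union> Graft t1 ` Y 2 \<union> (\<lambda>u. Graft u t1) ` Y 2 \<union> (\<lambda>u. Graft u Leaf) ` Y 3"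
proof -
  have "Y 4 = Y (Suc 3)" by simp
  also have "\<dots> = (\<Union>i\<in>{0,1,2,3}. \<Union>u\<in>Y i. Graft u ` Y (3 - i))"
    unfolding Y_Suc by (rule SUP_cong) auto
  finally show ?thesis by (auto simp: Y_0 Y_1[simplified])
qed

lemmas tree_defs = t321_def t312_def t131_def t213_def t123_def t21_def t12_def t1_def

text \<open>Inverse of \<open>tree_of\<close> on \<open>Y 2\<close>; it reads a 2-tree as the outer
  product it stands for. The value \<open>Rgt\<close> on other trees is a dummy.\<close>

definition side_of :: "pbtree \<Rightarrow> side" where
  "side_of y = (if y = t21 then Lft else Rgt)"

lemma side_of_simps [simp]: "side_of t21 = Lft" "side_of t12 = Rgt"
  by (simp_all add: side_of_def tree_defs)

lemma side_of_tree_of [simp]: "side_of (tree_of s) = s"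
  by (cases s) simp_all

lemma tree_of_side_of: "y \<in> Y 2 \<Longrightarrow> tree_of (side_of y) = y"
  by (auto simp: Y_2)

lemma tree_of_in_Y [simp]: "tree_of s \<in> Y 2"
  by (cases s) (simp_all add: Y_2)

text \<open>Each 3-tree encodes one of the five dialgebra axioms: its inner leaves give the inner products
  and its inner faces the outer products of the two bracketings.\<close>

definition associator :: "(side \<Rightarrow> 'a \<Rightarrow> 'a \<Rightarrow> 'a::ab_group_add) \<Rightarrow> pbtree \<Rightarrow> 'a \<Rightarrow> 'a \<Rightarrow> 'a \<Rightarrow> 'a" where
  "associator p y a b c = p (side_of (del 1 y)) (p (circ y 1) a b) c
     - p (side_of (del 2 y)) a (p (circ y 2) b c)"

lemma leaves_del: "y \<noteq> Leaf \<Longrightarrow> leaves (del i y) = leaves y - 1"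
proof (induction y arbitrary: i)
  case (Graft u v)
  show ?case
    using Graft leaves_pos[of u] leaves_pos[of v] by (auto simp: Suc_le_eq)
qed simp

lemma del_Y: "y \<in> Y (Suc n) \<Longrightarrow> del i y \<in> Y n"
  using leaves_del[of y i] by (cases "y = Leaf") (auto simp: Y_def)

lemma del_3:
  "del 0 t321 = t21" "del 0 t312 = t12" "del 0 t131 = t21" "del 0 t213 = t12" "del 0 t123 = t12"
  "del 1 t321 = t21" "del 1 t312 = t21" "del 1 t131 = t21" "del 1 t213 = t12" "del 1 t123 = t12"
  "del 2 t321 = t21" "del 2 t312 = t21" "del 2 t131 = t12" "del 2 t213 = t12" "del 2 t123 = t12"
  "del 3 t321 = t21" "del 3 t312 = t21" "del 3 t131 = t12" "del 3 t213 = t21" "del 3 t123 = t12"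
  by (simp_all add: tree_defs)

lemma circ_3:
  "circ t321 0 = Lft" "circ t312 0 = Lft" "circ t131 0 = Rgt" "circ t213 0 = Rgt" "circ t123 0 = Rgt"
  "circ t321 1 = Lft" "circ t312 1 = Lft" "circ t131 1 = Rgt" "circ t213 1 = Lft" "circ t123 1 = Rgt"
  "circ t321 2 = Lft" "circ t312 2 = Rgt" "circ t131 2 = Lft" "circ t213 2 = Rgt" "circ t123 2 = Rgt"
  "circ t321 3 = Lft" "circ t312 3 = Lft" "circ t131 3 = Lft" "circ t213 3 = Rgt" "circ t123 3 = Rgt"
  by (simp_all add: tree_defs circ_def)

lemma trees_3_distinct:
  "distinct [t321, t312, t131, t213, t123]" "distinct [t123, t213, t131, t312, t321]"
  by (simp_all add: tree_defs)

text \<open>Merges the five cases into one formula governed by the inner faces and inner leaves of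
  \<open>y\<close>, the same data that define \<open>associator\<close> and the inner faces of the
  coboundary.\<close>

lemma pre_lie_eq:
  assumes "y \<in> Y 3"
  shows "pre_lie F G y [a, b, c] = bil F (side_of (del 1 y)) (bil G (circ y 1) a b) c
     - bil F (side_of (del 2 y)) a (bil G (circ y 2) b c)"
proof -
  consider "y = t321" | "y = t312" | "y = t131" | "y = t213" | "y = t123"
    using assms by (auto simp: Y_3)
  then show ?thesis
    by cases (use trees_3_distinct in \<open>simp_all add: pre_lie_def del_3 circ_3
      del: One_nat_def\<close>)
qed

text \<open>These coincidences make the outer products of the two bracketings agree with the actions
  in the end faces of the coboundary; all cancellations over 3-trees rest on them.\<close>

lemma faces_3:
  assumes "y \<in> Y 3"
  shows "side_of (del 2 y) = circ y 0" "side_of (del 0 y) = circ y 2"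
    "side_of (del 1 y) = circ y 3" "side_of (del 3 y) = circ y 1"
  using assms by (auto simp: Y_3 del_3 circ_3 simp del: One_nat_def)

text \<open>The ten bracketings of \<open>a, b, c, d\<close> cancel in pairs; no axiom on \<open>p\<close> is involved.\<close>

lemma pentagon:
  assumes y: "y \<in> Y 4"
    and add: "\<And>s a. additive (p s a)" "\<And>s b. additive (\<lambda>a. p s a b)"
  shows "p (circ y 0) a (associator p (del 0 y) b c d) - associator p (del 1 y) (p (circ y 1) a b) c d
    + associator p (del 2 y) a (p (circ y 2) b c) d - associator p (del 3 y) a b (p (circ y 3) c d)
    + p (circ y 4) (associator p (del 4 y) a b c) d = 0"
proof -
  note diff = additive.diff[OF add(1)] additive.diff[OF add(2)]
  \<comment> \<open>The fourteen 4-trees. In each case additivity expands a product with an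
    associator into two bracketings.\<close>
  have "y \<in> set [Graft Leaf t321, Graft Leaf t312, Graft Leaf t131, Graft Leaf t213, Graft Leaf t123,
    Graft t1 t21, Graft t1 t12, Graft t21 t1, Graft t12 t1,
    Graft t321 Leaf, Graft t312 Leaf, Graft t131 Leaf, Graft t213 Leaf, Graft t123 Leaf]"
    using y by (auto simp: Y_4 Y_3 Y_2)
  then show ?thesis
    unfolding list.set insert_iff empty_iff
    by (elim disjE FalseE; hypsubst; simp add: tree_defs circ_def side_of_def associator_def diff)
qed

text \<open>The associators at \<open>t321\<close>, \<open>t312\<close>, \<open>t131\<close>,
  \<open>t213\<close>, \<open>t123\<close> are, up to sign, the differences of the two sides of the
  five axioms, in the order of \<open>dialgebra_laws\<close>.\<close>

lemma dialgebra_laws_eq_mod_iff: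
  "dialgebra_laws (eq_mod N) p \<longleftrightarrow>
    (\<forall>y\<in>Y 3. \<forall>u v w. \<forall>n\<le>N. associator p y u v w n = (0 :: 'd::ab_group_add))"
proof -
  have "(\<forall>y\<in>Y 3. \<forall>u v w. \<forall>n\<le>N. associator p y u v w n = 0) \<longleftrightarrow>
    (\<forall>u v w. \<forall>n\<le>N. associator p t321 u v w n = 0 \<and> associator p t312 u v w n = 0
      \<and> associator p t131 u v w n = 0 \<and> associator p t213 u v w n = 0 \<and> associator p t123 u v w n = 0)"
    by (auto simp: Y_3)
  also have "\<dots> \<longleftrightarrow> dialgebra_laws (eq_mod N) p"
    unfolding dialgebra_laws_def eq_mod_def
    by (simp add: associator_def del_3 circ_3 del: One_nat_def)
      (intro iffI allI impI conjI; blast intro: sym)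
  finally show ?thesis by simp
qed

section \<open>Operators on formal power series\<close>

definition const_series :: "'a::zero \<Rightarrow> nat \<Rightarrow> 'a" where
  "const_series a n = (if n = 0 then a else 0)"

definition shift :: "(nat \<Rightarrow> 'a::zero) \<Rightarrow> nat \<Rightarrow> 'a" where
  "shift u n = (case n of 0 \<Rightarrow> 0 | Suc m \<Rightarrow> u m)"

lemma const_series_simps [simp]: "const_series a 0 = a" "const_series a (Suc n) = 0"
  by (simp_all add: const_series_def)

lemma shift_simps [simp]: "shift u 0 = 0" "shift u (Suc n) = u n"
  by (simp_all add: shift_def)

lemma series_split: "u = const_series (u 0) + shift (\<lambda>n. u (Suc n))"
  for u :: "nat \<Rightarrow> 'a::ab_group_add"
  by (rule ext) (simp add: const_series_def shift_def split: nat.split)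

text \<open>Multiplication by \<open>t\<close> is \<open>shift\<close>. Additive maps commuting with it are determined by their
  constant inputs up to any finite order, which is all that is needed of \<open>K[[t]]\<close>-linearity.\<close>

definition tlinear :: "((nat \<Rightarrow> 'a::ab_group_add) \<Rightarrow> nat \<Rightarrow> 'b::ab_group_add) \<Rightarrow> bool" where
  "tlinear T \<longleftrightarrow> additive T \<and> (\<forall>u. T (shift u) = shift (T u))"

lemma shift_diff: "shift (u - v) = shift u - shift v" for u v :: "nat \<Rightarrow> 'a::ab_group_add"
  by (rule ext) (simp add: shift_def split: nat.split)

lemma tlinear_compose: "tlinear S \<Longrightarrow> tlinear T \<Longrightarrow> tlinear (\<lambda>u. T (S u))"
  by (simp add: tlinear_def additive_def)

lemma tlinear_diff: "tlinear S \<Longrightarrow> tlinear T \<Longrightarrow> tlinear (\<lambda>u. S u - T u)"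
  by (simp add: tlinear_def additive_def shift_diff)

text \<open>From \<open>u = u 0 + t * u'\<close>: the constant term is handled separately, and the
  tail \<open>u'\<close> enters one order lower. This is the recursion behind
  \<open>tlinear_vanish\<close> and \<open>tlinear_lead\<close>.\<close>

lemma tlinear_rec:
  assumes "tlinear T"
  shows "T u n = T (const_series (u 0)) n + shift (T (\<lambda>n. u (Suc n))) n"
proof -
  have "T u = T (const_series (u 0) + shift (\<lambda>n. u (Suc n)))"
    using series_split[of u] by simp
  also have "\<dots> = T (const_series (u 0)) + shift (T (\<lambda>n. u (Suc n)))"
    using assms by (simp add: tlinear_def additive_def)
  finally show ?thesis by simp
qed

lemma tlinear_vanish:
  assumes T: "tlinear T" and const: "\<And>a n. n \<le> N \<Longrightarrow> T (const_series a) n = 0"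
    and "n \<le> N"
  shows "T u n = 0"
  using \<open>n \<le> N\<close>
proof (induction n arbitrary: u)
  case 0
  then show ?case using tlinear_rec[OF T, of u 0] const by simp
next
  case (Suc n)
  then show ?case using tlinear_rec[OF T, of u "Suc n"] const by simp
qed

text \<open>The tail of the input reaches coefficient \<open>Suc N\<close> only through coefficient
  \<open>N\<close> of its image, which is zero.\<close>

lemma tlinear_lead:
  assumes T: "tlinear T" and van: "\<And>u n. n \<le> N \<Longrightarrow> T u n = 0"
  shows "T u (Suc N) = T (const_series (u 0)) (Suc N)"
  using tlinear_rec[OF T, of u "Suc N"] van by simp

section \<open>Coefficients of products of power series\<close>

lemma finite_triples: "finite {(i, j, k). i \<le> N \<and> i + j + k = (n::nat)}"
  by (rule finite_subset[of _ "{..n} \<times> {..n} \<times> {..n}"]) auto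

lemma finite_pairs: "finite {(i, j). i \<le> N \<and> i + j = (n::nat)}"
  by (rule finite_subset[of _ "{..n} \<times> {..n}"]) auto

lemma tlinear_tprod_left:
  assumes "\<And>i b. i \<le> N \<Longrightarrow> additive (\<lambda>a. bil (F i) s a b)"
  shows "tlinear (\<lambda>u. tprod N F s u v)"
  unfolding tlinear_def
proof (intro conjI allI)
  show "additive (\<lambda>u. tprod N F s u v)"
    using assms by (auto simp: additive_def tprod_def fun_eq_iff case_prod_beta
        simp flip: sum.distrib intro!: sum.cong)
next
  fix u
  show "tprod N F s (shift u) v = shift (tprod N F s u v)"
  proof
    fix n
    show "tprod N F s (shift u) v n = shift (tprod N F s u v) n"
    proof (cases n)
      case 0
      then show ?thesis using additive.zero[OF assms] by (auto simp: tprod_def intro!: sum.neutral)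
    next
      case (Suc m)
      \<comment> \<open>Terms with \<open>j = 0\<close> vanish because a shifted series has no
        constant term; the others are indexed by the predecessor of \<open>j\<close>.\<close>
      have "(\<Sum>(i, j, k)\<in>{(i, j, k). i \<le> N \<and> i + j + k = Suc m}. bil (F i) s (shift u j) (v k))
        = (\<Sum>(i, j, k)\<in>(\<lambda>(i, j, k). (i, Suc j, k)) ` {(i, j, k). i \<le> N \<and> i + j + k = m}.
            bil (F i) s (shift u j) (v k))"
      proof (rule sum.mono_neutral_right[OF finite_triples])
        show "\<forall>x\<in>{(i, j, k). i \<le> N \<and> i + j + k = Suc m} -
          (\<lambda>(i, j, k). (i, Suc j, k)) ` {(i, j, k). i \<le> N \<and> i + j + k = m}.
          (case x of (i, j, k) \<Rightarrow> bil (F i) s (shift u j) (v k)) = 0"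
        proof safe
          fix i j k assume *: "i \<le> N" "i + j + k = Suc m"
            "(i, j, k) \<notin> (\<lambda>(i, j, k). (i, Suc j, k)) ` {(i, j, k). i \<le> N \<and> i + j + k = m}"
          then have "j = 0" by (cases j) (auto simp: image_iff)
          then show "bil (F i) s (shift u j) (v k) = 0"
            using additive.zero[OF assms[OF \<open>i \<le> N\<close>]] by simp
        qed
      qed auto
      also have "\<dots> = (\<Sum>(i, j, k)\<in>{(i, j, k). i \<le> N \<and> i + j + k = m}. bil (F i) s (u j) (v k))"
        by (subst sum.reindex) (auto simp: inj_on_def intro!: sum.cong)
      finally show ?thesis by (simp add: Suc tprod_def)
    qed
  qed
qed

text \<open>Reversing argument lists passes to the opposite products, so statements about one
  argument of \<open>tprod\<close> transfer to the other.\<close>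

lemma tprod_commute: "tprod N F s u v = tprod N (\<lambda>i y xs. F i y (rev xs)) s v u"
proof
  fix n
  show "tprod N F s u v n = tprod N (\<lambda>i y xs. F i y (rev xs)) s v u n"
    unfolding tprod_def bil_def
    by (rule sum.reindex_bij_witness[of _ "\<lambda>(i, j, k). (i, k, j)" "\<lambda>(i, j, k). (i, k, j)"]) auto
qed

lemma tlinear_tprod_right:
  assumes "\<And>i a. i \<le> N \<Longrightarrow> additive (bil (F i) s a)"
  shows "tlinear (tprod N F s u)"
proof -
  have "tlinear (\<lambda>v. tprod N (\<lambda>i y xs. F i y (rev xs)) s v u)"
    by (rule tlinear_tprod_left) (use assms in \<open>simp add: bil_def[abs_def]\<close>)
  moreover have "tprod N F s u = (\<lambda>v. tprod N (\<lambda>i y xs. F i y (rev xs)) s v u)"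
    by (rule ext) (rule tprod_commute)
  ultimately show ?thesis by simp
qed

text \<open>Every index triple other than \<open>(0, 0, n)\<close> has \<open>k < n\<close>, where
  \<open>v\<close> vanishes. Thus at the leading order only the undeformed product is seen.\<close>

lemma tprod_lead_right:
  assumes bilin: "\<And>i a. i \<le> N \<Longrightarrow> additive (bil (F i) s a)"
    and van: "\<And>k. k < n \<Longrightarrow> v k = 0"
  shows "tprod N F s u v n = bil (F 0) s (u 0) (v n)"
proof -
  have "tprod N F s u v n = (\<Sum>(i, j, k)\<in>{(0, 0, n)}. bil (F i) s (u j) (v k))"
    unfolding tprod_def
  proof (rule sum.mono_neutral_right[OF finite_triples])
    show "\<forall>x\<in>{(i, j, k). i \<le> N \<and> i + j + k = n} - {(0, 0, n)}.
      (case x of (i, j, k) \<Rightarrow> bil (F i) s (u j) (v k)) = 0"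
    proof
      fix x assume x: "x \<in> {(i, j, k). i \<le> N \<and> i + j + k = n} - {(0, 0, n)}"
      obtain i j k where "x = (i, j, k)" by (cases x)
      with x have "i \<le> N" "k < n" "x = (i, j, k)" by auto
      then show "(case x of (i, j, k) \<Rightarrow> bil (F i) s (u j) (v k)) = 0"
        using additive.zero[OF bilin] van by simp
    qed
  qed auto
  then show ?thesis by simp
qed

lemma tprod_lead_left:
  assumes "\<And>i b. i \<le> N \<Longrightarrow> additive (\<lambda>a. bil (F i) s a b)"
    and "\<And>k. k < n \<Longrightarrow> u k = 0"
  shows "tprod N F s u v n = bil (F 0) s (u n) (v 0)"
  unfolding tprod_commute[of N F]
  by (subst tprod_lead_right) (use assms in \<open>simp_all add: bil_def[abs_def]\<close>)

lemma tprod_0: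
  assumes "\<And>i a. i \<le> N \<Longrightarrow> additive (bil (F i) s a)"
  shows "tprod N F s u v 0 = bil (F 0) s (u 0) (v 0)"
  by (rule tprod_lead_right) (use assms in simp_all)

lemma tprod_const_left:
  assumes "\<And>i b. i \<le> N \<Longrightarrow> additive (\<lambda>a. bil (F i) s a b)"
  shows "tprod N F s (const_series a) v n = (\<Sum>(i, k)\<in>{(i, k). i \<le> N \<and> i + k = n}. bil (F i) s a (v k))"
proof -
  have "tprod N F s (const_series a) v n = (\<Sum>(i, j, k)\<in>(\<lambda>(i, k). (i, 0, k)) ` {(i, k). i \<le> N \<and> i + k = n}.
      bil (F i) s (const_series a j) (v k))"
    unfolding tprod_def
  proof (rule sum.mono_neutral_right[OF finite_triples])
    show "\<forall>x\<in>{(i, j, k). i \<le> N \<and> i + j + k = n} - (\<lambda>(i, k). (i, 0, k)) ` {(i, k). i \<le> N \<and> i + k = n}.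
      (case x of (i, j, k) \<Rightarrow> bil (F i) s (const_series a j) (v k)) = 0"
      using additive.zero[OF assms] by (auto simp: image_iff const_series_def)
  qed auto
  also have "\<dots> = (\<Sum>(i, k)\<in>{(i, k). i \<le> N \<and> i + k = n}. bil (F i) s a (v k))"
    by (subst sum.reindex) (auto simp: inj_on_def intro!: sum.cong)
  finally show ?thesis .
qed

lemma tprod_const_right:
  assumes "\<And>i a. i \<le> N \<Longrightarrow> additive (bil (F i) s a)"
  shows "tprod N F s u (const_series b) n = (\<Sum>(i, j)\<in>{(i, j). i \<le> N \<and> i + j = n}. bil (F i) s (u j) b)"
  unfolding tprod_commute[of N F]
  by (subst tprod_const_left) (use assms in \<open>simp_all add: bil_def[abs_def]\<close>)

lemma tprod_const_const:
  assumes "\<And>i b. i \<le> N \<Longrightarrow> additive (\<lambda>a. bil (F i) s a b)" "\<And>i a. i \<le> N \<Longrightarrow> additive (bil (F i) s a)"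
  shows "tprod N F s (const_series a) (const_series b) n = (if n \<le> N then bil (F n) s a b else 0)"
proof -
  have "(\<Sum>(i, k)\<in>{(i, k). i \<le> N \<and> i + k = n}. bil (F i) s a (const_series b k))
    = (\<Sum>x\<in>(if n \<le> N then {(n, 0::nat)} else {}). bil (F n) s a b)"
  proof (rule sum.mono_neutral_cong_right[OF finite_pairs])
    show "\<forall>x\<in>{(i, k). i \<le> N \<and> i + k = n} - (if n \<le> N then {(n, 0::nat)} else {}).
      (case x of (i, k) \<Rightarrow> bil (F i) s a (const_series b k)) = 0"
      using additive.zero[OF assms(2)] by (auto simp: const_series_def split: if_splits)
  qed (auto split: if_splits)
  then show ?thesis
    by (subst tprod_const_left[OF assms(1)]) simp_all
qed

section \<open>Deformed products\<close>

lemma coboundary_1: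
  assumes "y \<in> Y 2"
  shows "coboundary p la ra 1 f y [a, b] = la (circ y 0) a (f (del 0 y) [b])
    - f (del 1 y) [p (circ y 1) a b] + ra (circ y 2) (f (del 2 y) [a]) b"
proof -
  have "{..1 + 1::nat} = {0, 1, 2}" by auto
  moreover have "Y (Suc (Suc 0)) = Y 2" by (simp add: numeral_2_eq_2)
  ultimately show ?thesis using assms by (simp add: coboundary_def face_def)
qed

lemma coboundary_2:
  assumes "y \<in> Y 3"
  shows "coboundary p la ra 2 f y [a, b, c] = la (circ y 0) a (f (del 0 y) [b, c])
    - f (del 1 y) [p (circ y 1) a b, c] + f (del 2 y) [a, p (circ y 2) b c]
    - ra (circ y 3) (f (del 3 y) [a, b]) c"
proof -
  have "{..2 + 1::nat} = {0, 1, 2, 3}" by auto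
  then show ?thesis using assms by (simp add: coboundary_def face_def)
qed

lemma coboundary_3:
  assumes "y \<in> Y 4"
  shows "coboundary p la ra 3 f y [a, b, c, d] = la (circ y 0) a (f (del 0 y) [b, c, d])
    - f (del 1 y) [p (circ y 1) a b, c, d] + f (del 2 y) [a, p (circ y 2) b c, d]
    - f (del 3 y) [a, b, p (circ y 3) c d] + ra (circ y 4) (f (del 4 y) [a, b, c]) d"
proof -
  have "{..3 + 1::nat} = {0, 1, 2, 3, 4}" by auto
  then show ?thesis using assms by (simp add: coboundary_def face_def)
qed

text \<open>Biadditivity carries the whole order-by-order computation; the locale is used for the
  products of \<open>D\<close> and of \<open>E\<close>, and again for the families extended to order
  \<open>Suc N\<close>.\<close>

locale additive_products =
  fixes N :: nat and F :: "nat \<Rightarrow> ('d, 'd::ab_group_add) cochain"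
  assumes add_left: "i \<le> N \<Longrightarrow> additive (\<lambda>a. bil (F i) s a b)"
    and add_right: "i \<le> N \<Longrightarrow> additive (bil (F i) s a)"
begin

lemma tlinear_left: "tlinear (\<lambda>u. tprod N F s u v)"
  by (rule tlinear_tprod_left) (rule add_left)

lemma tlinear_right: "tlinear (tprod N F s u)"
  by (rule tlinear_tprod_right) (rule add_right)

lemmas const_left = tprod_const_left[of N F, OF add_left, simplified]
  and const_right = tprod_const_right[of N F, OF add_right, simplified]
  and const_const = tprod_const_const[of N F, OF add_left add_right, simplified]
  and lead_left = tprod_lead_left[of N F, OF add_left, simplified]
  and lead_right = tprod_lead_right[of N F, OF add_right, simplified]
  and constant_term = tprod_0[of N F, OF add_right, simplified]

lemma tlinear_associator:
  "tlinear (\<lambda>u. associator (tprod N F) y u v w)"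
  "tlinear (\<lambda>v. associator (tprod N F) y u v w)"
  "tlinear (\<lambda>w. associator (tprod N F) y u v w)"
  unfolding associator_def
  by (intro tlinear_diff tlinear_left tlinear_right
    tlinear_compose[OF tlinear_left tlinear_left] tlinear_compose[OF tlinear_right tlinear_left]
    tlinear_compose[OF tlinear_left tlinear_right] tlinear_compose[OF tlinear_right tlinear_right])+

text \<open>On constants the outer product pairs \<open>F i\<close> with coefficient
  \<open>j\<close> of the inner product, which is \<open>F j\<close> for \<open>j \<le> N\<close>
  and zero beyond. Both bracketings use the same index set, so they combine into pre-Lie
  products.\<close>

lemma associator_const:
  assumes "y \<in> Y 3"
  shows "associator (tprod N F) y (const_series a) (const_series b) (const_series c) n
    = (\<Sum>(i, j)\<in>{(i, j). i \<le> N \<and> j \<le> N \<and> i + j = n}. pre_lie (F i) (F j) y [a, b, c])"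
proof -
  have "associator (tprod N F) y (const_series a) (const_series b) (const_series c) n
    = (\<Sum>(i, j)\<in>{(i, j). i \<le> N \<and> i + j = n}. if j \<le> N then pre_lie (F i) (F j) y [a, b, c] else 0)"
    unfolding associator_def minus_apply
      const_right[where u = "tprod N F s (const_series a) (const_series b)" for s]
      const_left[where v = "tprod N F s (const_series b) (const_series c)" for s]
      sum_subtractf[symmetric]
    using additive.zero[OF add_left] additive.zero[OF add_right]
    by (intro sum.cong) (auto simp: pre_lie_eq[OF assms] const_const)
  also have "\<dots> = (\<Sum>(i, j)\<in>{(i, j). i \<le> N \<and> j \<le> N \<and> i + j = n}. pre_lie (F i) (F j) y [a, b, c])"
    by (rule sum.mono_neutral_cong_right[OF finite_pairs]) (auto split: if_splits)
  finally show ?thesis .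
qed

text \<open>\<open>tlinear_vanish\<close> replaces constants by arbitrary series in one argument at
  a time, starting with the last.\<close>

lemma associator_vanish:
  assumes const: "\<And>a b c n. n \<le> M \<Longrightarrow>
      associator (tprod N F) y (const_series a) (const_series b) (const_series c) n = 0"
    and "n \<le> M"
  shows "associator (tprod N F) y u v w n = 0"
proof -
  have "associator (tprod N F) y (const_series a) (const_series b) w n = 0" if "n \<le> M" for a b w n
    using tlinear_vanish[OF tlinear_associator(3) const that] .
  then have "associator (tprod N F) y (const_series a) v w n = 0" if "n \<le> M" for a v w n
    using tlinear_vanish[OF tlinear_associator(2) _ that] by blast
  then show ?thesis
    using tlinear_vanish[OF tlinear_associator(1) _ \<open>n \<le> M\<close>] by blast
qed

text \<open>Translates the laws on series into the deformation equations for the coefficients: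
  \<open>associator_vanish\<close> reduces to constants, where \<open>associator_const\<close>
  applies.\<close>

lemma dialgebra_laws_iff:
  "dialgebra_laws (eq_mod N) (tprod N F) \<longleftrightarrow>
    (\<forall>y\<in>Y 3. \<forall>a b c. \<forall>n\<le>N. (\<Sum>(i, j)\<in>{(i, j). i + j = n}. pre_lie (F i) (F j) y [a, b, c]) = 0)"
proof -
  \<comment> \<open>Up to order \<open>N\<close> the truncation of the family imposes nothing on the
    indices.\<close>
  have "{(i, j). i \<le> N \<and> j \<le> N \<and> i + j = n} = {(i, j). i + j = n}" if "n \<le> N" for n
    using that by auto
  then have const: "associator (tprod N F) y (const_series a) (const_series b) (const_series c) n
    = (\<Sum>(i, j)\<in>{(i, j). i + j = n}. pre_lie (F i) (F j) y [a, b, c])"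
    if "y \<in> Y 3" "n \<le> N" for y a b c n
    using that by (simp add: associator_const)
  show ?thesis
    unfolding dialgebra_laws_eq_mod_iff
  proof (intro ball_cong refl iffI allI impI)
    fix y a b c n
    assume "y \<in> Y 3" "n \<le> N" "\<forall>u v w. \<forall>n\<le>N. associator (tprod N F) y u v w n = 0"
    then show "(\<Sum>(i, j)\<in>{(i, j). i + j = n}. pre_lie (F i) (F j) y [a, b, c]) = 0"
      unfolding const[OF \<open>y \<in> Y 3\<close> \<open>n \<le> N\<close>, symmetric] by blast
  next
    fix y u v w n
    assume y: "y \<in> Y 3" and "n \<le> N"
      and *: "\<forall>a b c. \<forall>n\<le>N. (\<Sum>(i, j)\<in>{(i, j). i + j = n}. pre_lie (F i) (F j) y [a, b, c]) = 0"
    show "associator (tprod N F) y u v w n = 0"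
    proof (rule associator_vanish[OF _ \<open>n \<le> N\<close>])
      show "associator (tprod N F) y (const_series a) (const_series b) (const_series c) n = 0"
        if "n \<le> N" for a b c n
        unfolding const[OF y that] using * that by blast
    qed
  qed
qed

lemma associator_lead:
  assumes laws: "dialgebra_laws (eq_mod N) (tprod N F)" and y: "y \<in> Y 3"
  shows "associator (tprod N F) y u v w (Suc N) = Ob_alg N F y [u 0, v 0, w 0]"
proof -
  have van: "\<And>u v w n. n \<le> N \<Longrightarrow> associator (tprod N F) y u v w n = 0"
    using laws y unfolding dialgebra_laws_eq_mod_iff by blast
  have "associator (tprod N F) y u v w (Suc N) = associator (tprod N F) y (const_series (u 0)) v w (Suc N)"
    by (rule tlinear_lead[OF tlinear_associator(1)]) (rule van)
  also have "\<dots> = associator (tprod N F) y (const_series (u 0)) (const_series (v 0)) w (Suc N)"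
    by (rule tlinear_lead[OF tlinear_associator(2)]) (rule van)
  also have "\<dots> = associator (tprod N F) y (const_series (u 0)) (const_series (v 0)) (const_series (w 0)) (Suc N)"
    by (rule tlinear_lead[OF tlinear_associator(3)]) (rule van)
  also have "\<dots> = Ob_alg N F y [u 0, v 0, w 0]"
  proof -
    \<comment> \<open>In total degree \<open>N + 1\<close>, truncation at \<open>N\<close> excludes
      exactly the pairs with a zero index, which leaves the index set of the obstruction.\<close>
    have "{(i, j). i \<le> N \<and> j \<le> N \<and> i + j = Suc N} = {(i, j). i + j = N + 1 \<and> i > 0 \<and> j > 0}"
    by auto
    then show ?thesis
      by (simp only: associator_const[OF y] Ob_alg_def)
  qed
  finally show ?thesis .
qed

lemma coboundary_Ob_alg:
  assumes laws: "dialgebra_laws (eq_mod N) (tprod N F)"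
  shows "coboundary (bil (F 0)) (bil (F 0)) (bil (F 0)) 3 (Ob_alg N F) = 0"
proof (intro ext)
  fix y xs
  show "coboundary (bil (F 0)) (bil (F 0)) (bil (F 0)) 3 (Ob_alg N F) y xs = 0 y xs"
  proof (cases "y \<in> Y 4 \<and> length xs = 4")
    case False
    then show ?thesis by (auto simp: coboundary_def)
  next
    case True
    then have y: "y \<in> Y 4" by simp
    from True obtain a b c d where xs: "xs = [a, b, c, d]"
      by (auto simp: length_Suc_conv eval_nat_numeral)
    have del: "del i y \<in> Y 3" for i
      using del_Y[of y 3 i] y by simp
    have van: "associator (tprod N F) (del i y) u v w n = 0" if "n \<le> N" for i u v w n
      using laws del that unfolding dialgebra_laws_eq_mod_iff by blast
    let ?a = "const_series a" and ?b = "const_series b" and ?c = "const_series c" and ?d = "const_series d"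
    \<comment> \<open>The pentagon for the deformed products on constant series, read at coefficient
      \<open>Suc N\<close>.\<close>
    have "(tprod N F (circ y 0) ?a (associator (tprod N F) (del 0 y) ?b ?c ?d)
      - associator (tprod N F) (del 1 y) (tprod N F (circ y 1) ?a ?b) ?c ?d
      + associator (tprod N F) (del 2 y) ?a (tprod N F (circ y 2) ?b ?c) ?d
      - associator (tprod N F) (del 3 y) ?a ?b (tprod N F (circ y 3) ?c ?d)
      + tprod N F (circ y 4) (associator (tprod N F) (del 4 y) ?a ?b ?c) ?d) (Suc N) = 0"
      using tlinear_left tlinear_right by (subst pentagon[OF y]) (auto simp: tlinear_def)
    \<comment> \<open>In the outer terms the associators vanish through order \<open>N\<close>, so
      their leading coefficient is multiplied by \<open>F 0\<close>. In the inner terms only the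
      constant term of a product matters, and it too is given by \<open>F 0\<close>.\<close>
    then show ?thesis
      by (simp add: xs coboundary_3[OF y] lead_left lead_right van associator_lead[OF laws del] constant_term)
  qed
qed

end

section \<open>Deformed morphisms\<close>

text \<open>The map on power series induced by \<open>f 0 + f 1 t + ... + f N t^N\<close>, the
  counterpart of \<open>tprod\<close>.\<close>

definition tmap :: "nat \<Rightarrow> (nat \<Rightarrow> 'a \<Rightarrow> 'b) \<Rightarrow> (nat \<Rightarrow> 'a) \<Rightarrow> nat \<Rightarrow> 'b::ab_group_add" where
  "tmap N f u n = (\<Sum>(i, j)\<in>{(i, j). i \<le> N \<and> i + j = n}. f i (u j))"

lemma tlinear_tmap:
  assumes "\<And>i. i \<le> N \<Longrightarrow> additive (f i)"
  shows "tlinear (tmap N f)"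
  unfolding tlinear_def
proof (intro conjI allI)
  show "additive (tmap N f)"
    using assms by (auto simp: additive_def tmap_def fun_eq_iff case_prod_beta
        simp flip: sum.distrib intro!: sum.cong)
next
  fix u
  show "tmap N f (shift u) = shift (tmap N f u)"
  proof
    fix n
    show "tmap N f (shift u) n = shift (tmap N f u) n"
    proof (cases n)
      case 0
      then show ?thesis using additive.zero[OF assms] by (auto simp: tmap_def intro!: sum.neutral)
    next
      case (Suc m)
      have "(\<Sum>(i, j)\<in>{(i, j). i \<le> N \<and> i + j = Suc m}. f i (shift u j))
        = (\<Sum>(i, j)\<in>(\<lambda>(i, j). (i, Suc j)) ` {(i, j). i \<le> N \<and> i + j = m}. f i (shift u j))"
      proof (rule sum.mono_neutral_right[OF finite_pairs])
        show "\<forall>x\<in>{(i, j). i \<le> N \<and> i + j = Suc m} -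
          (\<lambda>(i, j). (i, Suc j)) ` {(i, j). i \<le> N \<and> i + j = m}.
          (case x of (i, j) \<Rightarrow> f i (shift u j)) = 0"
        proof safe
          fix i j assume *: "i \<le> N" "i + j = Suc m"
            "(i, j) \<notin> (\<lambda>(i, j). (i, Suc j)) ` {(i, j). i \<le> N \<and> i + j = m}"
          then have "j = 0" by (cases j) (auto simp: image_iff)
          then show "f i (shift u j) = 0"
            using additive.zero[OF assms[OF \<open>i \<le> N\<close>]] by simp
        qed
      qed auto
      also have "\<dots> = (\<Sum>(i, j)\<in>{(i, j). i \<le> N \<and> i + j = m}. f i (u j))"
        by (subst sum.reindex) (auto simp: inj_on_def intro!: sum.cong)
      finally show ?thesis by (simp add: Suc tmap_def)
    qed
  qed
qed

lemma tmap_lead: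
  assumes add: "\<And>i. i \<le> N \<Longrightarrow> additive (f i)"
    and van: "\<And>k. k < n \<Longrightarrow> u k = 0"
  shows "tmap N f u n = f 0 (u n)"
proof -
  have "tmap N f u n = (\<Sum>(i, j)\<in>{(0, n)}. f i (u j))"
    unfolding tmap_def
  proof (rule sum.mono_neutral_right[OF finite_pairs])
    show "\<forall>x\<in>{(i, j). i \<le> N \<and> i + j = n} - {(0, n)}. (case x of (i, j) \<Rightarrow> f i (u j)) = 0"
    proof
      fix x assume x: "x \<in> {(i, j). i \<le> N \<and> i + j = n} - {(0, n)}"
      obtain i j where "x = (i, j)" by (cases x)
      with x have "i \<le> N" "j < n" "x = (i, j)" by auto
      then show "(case x of (i, j) \<Rightarrow> f i (u j)) = 0"
        using additive.zero[OF add] van by simp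
    qed
  qed auto
  then show ?thesis by simp
qed

lemma tmap_const:
  assumes "\<And>i. i \<le> N \<Longrightarrow> additive (f i)"
  shows "tmap N f (const_series a) n = (if n \<le> N then f n a else 0)"
proof -
  have "tmap N f (const_series a) n = (\<Sum>x\<in>(if n \<le> N then {(n, 0::nat)} else {}). f n a)"
    unfolding tmap_def
  proof (rule sum.mono_neutral_cong_right[OF finite_pairs])
    show "\<forall>x\<in>{(i, k). i \<le> N \<and> i + k = n} - (if n \<le> N then {(n, 0)} else {}).
      (case x of (i, k) \<Rightarrow> f i (const_series a k)) = 0"
      using additive.zero[OF assms] by (auto simp: const_series_def split: if_splits)
  qed (auto split: if_splits)
  then show ?thesis by simp
qed

text \<open>By \<open>faces_3\<close> the mixed terms cancel: \<open>q (f a) (f (p b c))\<close>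
  between faces 0 and 2, \<open>q (f (p a b)) (f c)\<close> between faces 1 and 3. What remains is
  \<open>f\<close> of the associator of \<open>p\<close> and the associator of
  \<open>q\<close>.\<close>

lemma morphism_pentagon:
  fixes p :: "side \<Rightarrow> 'a \<Rightarrow> 'a \<Rightarrow> 'a::ab_group_add" and q :: "side \<Rightarrow> 'b \<Rightarrow> 'b \<Rightarrow> 'b::ab_group_add"
  assumes y: "y \<in> Y 3"
    and f: "additive f" and q: "\<And>s a. additive (q s a)" "\<And>s b. additive (\<lambda>a. q s a b)"
  defines "m s a b \<equiv> q s (f a) (f b) - f (p s a b)"
  shows "f (associator p y a b c) - associator q y (f a) (f b) (f c)
    - (q (circ y 0) (f a) (m (side_of (del 0 y)) b c) - m (side_of (del 1 y)) (p (circ y 1) a b) c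
      + m (side_of (del 2 y)) a (p (circ y 2) b c) - q (circ y 3) (m (side_of (del 3 y)) a b) (f c)) = 0"
  unfolding m_def associator_def faces_3[OF y]
  by (simp add: additive.diff[OF f] additive.diff[OF q(1)] additive.diff[OF q(2)])

text \<open>The morphism clause of \<open>deformation\<close>, isolated so that it can be compared
  at orders \<open>N\<close> and \<open>Suc N\<close>.\<close>

definition multiplicative :: "(nat \<Rightarrow> ('d, 'e::ab_group_add) mcochain) \<Rightarrow> nat \<Rightarrow> bool" where
  "multiplicative \<Theta> M \<longleftrightarrow> (\<forall>s a b. \<forall>n\<le>M.
     (\<Sum>i\<le>n. Fpsi \<Theta> i (bil (FD \<Theta> (n - i)) s a b)) =
     (\<Sum>(i, j, k) \<in> {(i, j, k). i + j + k = n}. bil (FE \<Theta> i) s (Fpsi \<Theta> j a) (Fpsi \<Theta> k b)))"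

lemma Ob_psi_eq: "y \<in> Y 2 \<Longrightarrow> Ob_psi N \<Theta> y [a, b] = Ob_bil N \<Theta> (side_of y) a b"
  by (auto simp: Y_2 Ob_psi_def)

locale additive_morphism = D: additive_products N "FD \<Theta>" + E: additive_products N "FE \<Theta>"
  for N and \<Theta> :: "nat \<Rightarrow> ('d::ab_group_add, 'e::ab_group_add) mcochain" +
  assumes add_psi: "i \<le> N \<Longrightarrow> additive (Fpsi \<Theta> i)"
begin

definition defect :: "side \<Rightarrow> (nat \<Rightarrow> 'd) \<Rightarrow> (nat \<Rightarrow> 'd) \<Rightarrow> nat \<Rightarrow> 'e" where
  "defect s u v = tprod N (FE \<Theta>) s (tmap N (Fpsi \<Theta>) u) (tmap N (Fpsi \<Theta>) v)
     - tmap N (Fpsi \<Theta>) (tprod N (FD \<Theta>) s u v)"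

lemma tlinear_psi: "tlinear (tmap N (Fpsi \<Theta>))"
  by (rule tlinear_tmap) (rule add_psi)

lemmas psi_const = tmap_const[of N "Fpsi \<Theta>", OF add_psi, simplified]
  and psi_lead = tmap_lead[of N "Fpsi \<Theta>", OF add_psi, simplified]

lemma psi_0: "tmap N (Fpsi \<Theta>) u 0 = Fpsi \<Theta> 0 (u 0)"
  by (rule psi_lead) simp

lemma tlinear_defect: "tlinear (\<lambda>u. defect s u v)" "tlinear (\<lambda>v. defect s u v)"
  unfolding defect_def
  by (intro tlinear_diff tlinear_compose[OF tlinear_psi E.tlinear_left]
      tlinear_compose[OF tlinear_psi E.tlinear_right] tlinear_compose[OF D.tlinear_left tlinear_psi]
      tlinear_compose[OF D.tlinear_right tlinear_psi])+

lemma defect_const: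
  "defect s (const_series a) (const_series b) n =
    (\<Sum>(i, j, k)\<in>{(i, j, k). i \<le> N \<and> j \<le> N \<and> k \<le> N \<and> i + j + k = n}.
      bil (FE \<Theta> i) s (Fpsi \<Theta> j a) (Fpsi \<Theta> k b))
    - (\<Sum>(i, j)\<in>{(i, j). i \<le> N \<and> j \<le> N \<and> i + j = n}. Fpsi \<Theta> i (bil (FD \<Theta> j) s a b))"
proof -
  have "tprod N (FE \<Theta>) s (tmap N (Fpsi \<Theta>) (const_series a)) (tmap N (Fpsi \<Theta>) (const_series b)) n
    = (\<Sum>(i, j, k)\<in>{(i, j, k). i \<le> N \<and> j \<le> N \<and> k \<le> N \<and> i + j + k = n}.
      bil (FE \<Theta> i) s (Fpsi \<Theta> j a) (Fpsi \<Theta> k b))"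
    unfolding tprod_def
    \<comment> \<open>For \<open>j > N\<close> or \<open>k > N\<close> the deformed map has
      coefficient zero on constants, and additivity kills the product.\<close>
    by (rule sum.mono_neutral_cong_right[OF finite_triples])
      (use additive.zero[OF E.add_left] additive.zero[OF E.add_right] in
        \<open>auto simp: psi_const split: if_splits\<close>)
  moreover have "tmap N (Fpsi \<Theta>) (tprod N (FD \<Theta>) s (const_series a) (const_series b)) n
    = (\<Sum>(i, j)\<in>{(i, j). i \<le> N \<and> j \<le> N \<and> i + j = n}. Fpsi \<Theta> i (bil (FD \<Theta> j) s a b))"
    unfolding tmap_def
    by (rule sum.mono_neutral_cong_right[OF finite_pairs])
      (use additive.zero[OF add_psi] in \<open>auto simp: D.const_const split: if_splits\<close>)
  ultimately show ?thesis by (simp add: defect_def)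
qed

lemma defect_vanish:
  assumes const: "\<And>a b n. n \<le> M \<Longrightarrow> defect s (const_series a) (const_series b) n = 0"
    and "n \<le> M"
  shows "defect s u v n = 0"
proof -
  have "defect s (const_series a) v n = 0" if "n \<le> M" for a v n
    using tlinear_vanish[OF tlinear_defect(2) const that] .
  then show ?thesis
    using tlinear_vanish[OF tlinear_defect(1) _ \<open>n \<le> M\<close>] by blast
qed

lemma multiplicative_defect:
  assumes "multiplicative \<Theta> N" "n \<le> N"
  shows "defect s u v n = 0"
proof (rule defect_vanish[OF _ \<open>n \<le> N\<close>])
  fix a b n assume "n \<le> N"
  then have "{(i, j, k). i \<le> N \<and> j \<le> N \<and> k \<le> N \<and> i + j + k = n} = {(i, j, k). i + j + k = n}"
    by auto
  moreover have "(\<Sum>(i, j)\<in>{(i, j). i \<le> N \<and> j \<le> N \<and> i + j = n}. Fpsi \<Theta> i (bil (FD \<Theta> j) s a b))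
    = (\<Sum>i\<le>n. Fpsi \<Theta> i (bil (FD \<Theta> (n - i)) s a b))"
    by (rule sum.reindex_bij_witness[of _ "\<lambda>i. (i, n - i)" fst]) (use \<open>n \<le> N\<close> in auto)
  ultimately show "defect s (const_series a) (const_series b) n = 0"
    using assms(1) \<open>n \<le> N\<close> by (simp add: defect_const multiplicative_def)
qed

lemma defect_lead:
  assumes "multiplicative \<Theta> N"
  shows "defect s u v (Suc N) = Ob_bil N \<Theta> s (u 0) (v 0)"
proof -
  note van = multiplicative_defect[OF assms]
  have "defect s u v (Suc N) = defect s (const_series (u 0)) v (Suc N)"
    by (rule tlinear_lead[OF tlinear_defect(1)]) (rule van)
  also have "\<dots> = defect s (const_series (u 0)) (const_series (v 0)) (Suc N)"
    by (rule tlinear_lead[OF tlinear_defect(2)]) (rule van)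
  also have "\<dots> = Ob_bil N \<Theta> s (u 0) (v 0)"
  proof -
    \<comment> \<open>Since \<open>j = N + 1 - i\<close>, the bound \<open>j \<le> N\<close> says
      \<open>i \<ge> 1\<close>, which gives the range in \<open>Ob_bil\<close>.\<close>
    have "(\<Sum>(i, j)\<in>{(i, j). i \<le> N \<and> j \<le> N \<and> i + j = Suc N}. Fpsi \<Theta> i (bil (FD \<Theta> j) s (u 0) (v 0)))
      = (\<Sum>i = 1..N. Fpsi \<Theta> i (bil (FD \<Theta> (N + 1 - i)) s (u 0) (v 0)))"
      by (rule sum.reindex_bij_witness[of _ "\<lambda>i. (i, Suc N - i)" fst])
        (auto, metis diff_add_inverse)
    then show ?thesis by (simp add: defect_const Ob_bil_def)
  qed
  finally show ?thesis .
qed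

text \<open>The left-hand side is the third component of \<open>dm\<close> in degree 3, applied to
  the obstruction.\<close>

lemma Ob_psi_cocycle:
  assumes laws: "dialgebra_laws (eq_mod N) (tprod N (FD \<Theta>))"
      "dialgebra_laws (eq_mod N) (tprod N (FE \<Theta>))"
    and mult: "multiplicative \<Theta> N" and y: "y \<in> Y 3"
  shows "Fpsi \<Theta> 0 (Ob_alg N (FD \<Theta>) y [a, b, c])
    - Ob_alg N (FE \<Theta>) y [Fpsi \<Theta> 0 a, Fpsi \<Theta> 0 b, Fpsi \<Theta> 0 c]
    - coboundary (bil (FD \<Theta> 0)) (\<lambda>s a e. bil (FE \<Theta> 0) s (Fpsi \<Theta> 0 a) e)
        (\<lambda>s e a. bil (FE \<Theta> 0) s e (Fpsi \<Theta> 0 a)) 2 (Ob_psi N \<Theta>) y [a, b, c] = 0"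
proof -
  let ?p = "tprod N (FD \<Theta>)" and ?q = "tprod N (FE \<Theta>)" and ?f = "tmap N (Fpsi \<Theta>)"
  let ?a = "const_series a" and ?b = "const_series b" and ?c = "const_series c"
  have del: "del i y \<in> Y 2" for i
    using del_Y[of y 2 i] y by simp
  have van: "associator ?p y u v w n = 0" if "n \<le> N" for u v w n
    using laws(1) y that unfolding dialgebra_laws_eq_mod_iff by blast
  note dvan = multiplicative_defect[OF mult]
  have "?f (associator ?p y ?a ?b ?c) - associator ?q y (?f ?a) (?f ?b) (?f ?c)
    - (?q (circ y 0) (?f ?a) (defect (side_of (del 0 y)) ?b ?c)
      - defect (side_of (del 1 y)) (?p (circ y 1) ?a ?b) ?c
      + defect (side_of (del 2 y)) ?a (?p (circ y 2) ?b ?c)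
      - ?q (circ y 3) (defect (side_of (del 3 y)) ?a ?b) (?f ?c)) = 0"
    unfolding defect_def
    by (rule morphism_pentagon[OF y, where f = ?f and p = ?p and q = ?q])
      (use tlinear_psi E.tlinear_left E.tlinear_right in \<open>simp_all add: tlinear_def\<close>)
  \<comment> \<open>At coefficient \<open>Suc N\<close> associators and defects are at their leading
    order, so they become obstruction components and all surrounding maps and products become
    undeformed.\<close>
  from arg_cong[where f = "\<lambda>u. u (Suc N)", OF this] show ?thesis
    by (simp add: coboundary_2[OF y] Ob_psi_eq[OF del] psi_lead van D.associator_lead[OF laws(1) y]
        E.associator_lead[OF laws(2) y] E.lead_left E.lead_right dvan defect_lead[OF mult]
        psi_0 D.constant_term)
qed

end

section \<open>Spaces of cochains\<close>

lemma linear_additive: "Vector_Spaces.linear s1 s2 f \<Longrightarrow> additive f"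
  by (simp add: Vector_Spaces.linear_iff additive_def)

lemma linear_comp: "Vector_Spaces.linear s1 s2 f \<Longrightarrow> Vector_Spaces.linear s2 s3 g \<Longrightarrow>
    Vector_Spaces.linear s1 s3 (\<lambda>x. g (f x))"
  by (simp add: Vector_Spaces.linear_iff)

lemma linear_zero_fun: "vector_space s1 \<Longrightarrow> vector_space s2 \<Longrightarrow> Vector_Spaces.linear s1 s2 (\<lambda>x. 0)"
  by (simp add: Vector_Spaces.linear_iff module.scale_zero_right module_iff_vector_space)

lemma linear_sub: "Vector_Spaces.linear s1 s2 f \<Longrightarrow> Vector_Spaces.linear s1 s2 g \<Longrightarrow>
    Vector_Spaces.linear s1 s2 (\<lambda>x. f x - g x)"
  by (auto simp: Vector_Spaces.linear_iff module.scale_right_diff_distrib module_iff_vector_space)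

lemma linear_sum:
  assumes "vector_space s1" "vector_space s2" "\<And>i. i \<in> I \<Longrightarrow> Vector_Spaces.linear s1 s2 (f i)"
  shows "Vector_Spaces.linear s1 s2 (\<lambda>x. \<Sum>i\<in>I. f i x)"
proof -
  have "s2 c (\<Sum>i\<in>I. f i x) = (\<Sum>i\<in>I. s2 c (f i x))" for c x
    using assms(2) by (simp add: module.scale_sum_right module_iff_vector_space)
  then show ?thesis
    using assms by (auto simp: Vector_Spaces.linear_iff sum.distrib intro!: sum.cong)
qed

section \<open>Multilinearity of cochains of low degree\<close>

lemma CY_2_linear:
  assumes "F \<in> CY sD sM 2"
  shows "Vector_Spaces.linear sD sM (bil F s a)" "Vector_Spaces.linear sD sM (\<lambda>a. bil F s a b)"
proof -
  have *: "Vector_Spaces.linear sD sM (\<lambda>x. F (tree_of s) (xs[i := x]))" if "length xs = 2" "i < 2" for xs i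
    using assms that tree_of_in_Y[of s] unfolding CY_def by blast
  show "Vector_Spaces.linear sD sM (bil F s a)"
    \<comment> \<open>The entry at position 1 is overwritten, so its initial value is
      arbitrary.\<close>
    using *[of "[a, a]" 1] by (simp add: bil_def[abs_def])
  show "Vector_Spaces.linear sD sM (\<lambda>a. bil F s a b)"
    using *[of "[b, b]" 0] by (simp add: bil_def)
qed

lemma CY_1_linear:
  assumes "f \<in> CY sD sM 1"
  shows "Vector_Spaces.linear sD sM (lin f)"
proof -
  have "\<forall>xs i. length xs = 1 \<longrightarrow> i < 1 \<longrightarrow> Vector_Spaces.linear sD sM (\<lambda>x. f t1 (xs[i := x]))"
    using assms Y_1 unfolding CY_def by blast
  from this[rule_format, of "[undefined]" 0] show ?thesis by (simp add: lin_def[abs_def])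
qed

lemma CY_outside: "f \<in> CY sD sM n \<Longrightarrow> \<not> (y \<in> Y n \<and> length xs = n) \<Longrightarrow> f y xs = 0"
  by (simp add: CY_def)

lemma CY_2_I:
  assumes "\<And>y a. y \<in> Y 2 \<Longrightarrow> Vector_Spaces.linear sD sM (\<lambda>b. f y [a, b])"
    and "\<And>y b. y \<in> Y 2 \<Longrightarrow> Vector_Spaces.linear sD sM (\<lambda>a. f y [a, b])"
    and "\<And>y xs. \<not> (y \<in> Y 2 \<and> length xs = 2) \<Longrightarrow> f y xs = 0"
  shows "f \<in> CY sD sM 2"
proof -
  have "Vector_Spaces.linear sD sM (\<lambda>x. f y (xs[i := x]))" if *: "y \<in> Y 2" "length xs = 2" "i < 2" for y xs i
  proof -
    obtain a b where "xs = [a, b]"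
      using *(2) by (auto simp: length_Suc_conv numeral_2_eq_2)
    with * assms show ?thesis by (auto simp: less_Suc_eq numeral_2_eq_2)
  qed
  with assms(3) show ?thesis unfolding CY_def by blast
qed

lemma CY_3_I:
  assumes "\<And>y a b. y \<in> Y 3 \<Longrightarrow> Vector_Spaces.linear sD sM (\<lambda>c. f y [a, b, c])"
    and "\<And>y a c. y \<in> Y 3 \<Longrightarrow> Vector_Spaces.linear sD sM (\<lambda>b. f y [a, b, c])"
    and "\<And>y b c. y \<in> Y 3 \<Longrightarrow> Vector_Spaces.linear sD sM (\<lambda>a. f y [a, b, c])"
    and "\<And>y xs. \<not> (y \<in> Y 3 \<and> length xs = 3) \<Longrightarrow> f y xs = 0"
  shows "f \<in> CY sD sM 3"
proof -
  have "Vector_Spaces.linear sD sM (\<lambda>x. f y (xs[i := x]))" if *: "y \<in> Y 3" "length xs = 3" "i < 3" for y xs i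
  proof -
    obtain a b c where "xs = [a, b, c]"
      using *(2) by (auto simp: length_Suc_conv numeral_3_eq_3)
    with * assms show ?thesis by (auto simp: less_Suc_eq numeral_3_eq_3)
  qed
  with assms(4) show ?thesis unfolding CY_def by blast
qed

section \<open>The obstruction is a 3-cochain\<close>

lemma pre_lie_outside: "\<not> (y \<in> Y 3 \<and> length xs = 3) \<Longrightarrow> pre_lie F G y xs = 0"
  by (auto simp: pre_lie_def Y_3 split: list.split)

lemma Ob_alg_in_CY:
  assumes "vector_space sD" and F: "\<And>i. i \<le> N \<Longrightarrow> F i \<in> CY sD sD 2"
  shows "Ob_alg N F \<in> CY sD sD 3"
proof (rule CY_3_I)
  \<comment> \<open>Applies to all summands: positive \<open>i\<close>, \<open>j\<close> with
    \<open>i + j = N + 1\<close> are both at most \<open>N\<close>.\<close>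
  note lin = CY_2_linear[OF F]
  fix y :: pbtree and a b c :: 'b
  assume y: "y \<in> Y 3"
  show "Vector_Spaces.linear sD sD (\<lambda>c. Ob_alg N F y [a, b, c])"
    unfolding Ob_alg_def pre_lie_eq[OF y] case_prod_beta
    by (intro linear_sum linear_sub lin linear_comp[OF lin(1) lin(1)] assms(1)) auto
  show "Vector_Spaces.linear sD sD (\<lambda>b. Ob_alg N F y [a, b, c])"
    unfolding Ob_alg_def pre_lie_eq[OF y] case_prod_beta
    by (intro linear_sum linear_sub linear_comp[OF lin(2) lin(1)] linear_comp[OF lin(1) lin(2)] assms(1)) auto
  show "Vector_Spaces.linear sD sD (\<lambda>a. Ob_alg N F y [a, b, c])"
    unfolding Ob_alg_def pre_lie_eq[OF y] case_prod_beta
    by (intro linear_sum linear_sub lin linear_comp[OF lin(2) lin(2)] assms(1)) auto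
next
  fix y :: pbtree and xs :: "'b list"
  assume "\<not> (y \<in> Y 3 \<and> length xs = 3)"
  then show "Ob_alg N F y xs = 0"
    by (simp add: Ob_alg_def pre_lie_outside)
qed

lemma Ob_psi_outside: "\<not> (y \<in> Y 2 \<and> length xs = 2) \<Longrightarrow> Ob_psi N \<Theta> y xs = 0"
  by (auto simp: Ob_psi_def Y_2 split: list.split)

lemma CYm_parts:
  assumes "\<Theta> i \<in> CYm sD sE 2"
  shows "FD \<Theta> i \<in> CY sD sD 2" "FE \<Theta> i \<in> CY sE sE 2" "Vector_Spaces.linear sD sE (Fpsi \<Theta> i)"
  using assms CY_1_linear[of "snd (snd (\<Theta> i))" sD sE]
  by (auto simp: CYm_def FD_def FE_def Fpsi_def)

lemma Ob_psi_in_CY: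
  assumes "vector_space sD" "vector_space sE" and \<Theta>: "\<And>i. i \<le> N \<Longrightarrow> \<Theta> i \<in> CYm sD sE 2"
  shows "Ob_psi N \<Theta> \<in> CY sD sE 2"
proof (rule CY_2_I)
  note D = CY_2_linear[OF CYm_parts(1)[OF \<Theta>]] and E = CY_2_linear[OF CYm_parts(2)[OF \<Theta>]]
    and psi = CYm_parts(3)[OF \<Theta>]
  fix y :: pbtree and a b :: 'b
  assume y: "y \<in> Y 2"
  show "Vector_Spaces.linear sD sE (\<lambda>b. Ob_psi N \<Theta> y [a, b])"
    unfolding Ob_psi_eq[OF y] Ob_bil_def case_prod_beta
    by (intro linear_sum linear_sub linear_comp[OF psi E(1)] linear_comp[OF D(1) psi] assms(1,2)) auto
  show "Vector_Spaces.linear sD sE (\<lambda>a. Ob_psi N \<Theta> y [a, b])"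
    unfolding Ob_psi_eq[OF y] Ob_bil_def case_prod_beta
    by (intro linear_sum linear_sub linear_comp[OF psi E(2)] linear_comp[OF D(2) psi] assms(1,2)) auto
qed (rule Ob_psi_outside)

lemma CY_diff: "f \<in> CY sD sM n \<Longrightarrow> g \<in> CY sD sM n \<Longrightarrow> f - g \<in> CY sD sM n"
  by (auto simp: CY_def intro: linear_sub)

lemma CY_zero: "vector_space sD \<Longrightarrow> vector_space sM \<Longrightarrow> 0 \<in> CY sD sM n"
  by (auto simp: CY_def intro: linear_zero_fun)

section \<open>Additivity of the differentials\<close>

lemma additive_coboundary:
  assumes "\<And>s a. additive (la s a)" "\<And>s a. additive (\<lambda>m. ra s m a)"
  shows "additive (coboundary p la ra n)"
proof
  fix f g :: "('a, 'b) cochain"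
  have face: "face p la ra n i (f + g) y xs = face p la ra n i f y xs + face p la ra n i g y xs" for i y xs
    using additive.add[OF assms(1)] additive.add[OF assms(2)] by (simp add: face_def)
  show "coboundary p la ra n (f + g) = coboundary p la ra n f + coboundary p la ra n g"
    by (intro ext) (auto simp: coboundary_def face simp flip: sum.distrib intro!: sum.cong)
qed

lemma additive_dm:
  assumes "\<And>s a. additive (pD s a)" "\<And>s b. additive (\<lambda>a. pD s a b)"
    and "\<And>s a. additive (pE s a)" "\<And>s b. additive (\<lambda>a. pE s a b)" "additive \<psi>"
  shows "additive (dm pD pE \<psi> n)"
proof
  fix x y
  show "dm pD pE \<psi> n (x + y) = dm pD pE \<psi> n x + dm pD pE \<psi> n y"
    using additive.add[OF additive_coboundary[of pD pD pD n]]
      additive.add[OF additive_coboundary[of pE pE pE n]]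
      additive.add[OF additive_coboundary[of "\<lambda>s a e. pE s (\<psi> a) e" "\<lambda>s e a. pE s e (\<psi> a)" pD "n - 1"]]
      additive.add[OF assms(5)] assms
    by (cases x; cases y) (auto simp: dm_def fun_eq_iff)
qed

section \<open>The coefficient of the new power\<close>

text \<open>With \<open>F\<close> the given products, \<open>faces_3\<close> identifies
  \<open>F \<circ> G\<close> with face 3 minus face 0 of \<open>G\<close>, and
  \<open>G \<circ> F\<close> with face 1 minus face 2. This accounts for the minus sign.\<close>

lemma pre_lie_coboundary:
  assumes y: "y \<in> Y 3"
  shows "pre_lie F G y [a, b, c] + pre_lie G F y [a, b, c]
    = - coboundary (bil F) (bil F) (bil F) 2 G y [a, b, c]"
proof -
  have "G (del i y) xs = G (tree_of (side_of (del i y))) xs" for i xs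
    using tree_of_side_of[OF del_Y[of y 2 i]] y by simp
  then show ?thesis
    by (simp add: coboundary_2[OF y] pre_lie_eq[OF y] faces_3[OF y] bil_def del: One_nat_def)
qed

text \<open>Separates the two terms with an index \<open>Suc N\<close>, the only ones in which a new
  coefficient occurs.\<close>

lemma sum_pairs_Suc:
  fixes g :: "nat \<Rightarrow> nat \<Rightarrow> 'a::comm_monoid_add"
  shows "(\<Sum>(i, j)\<in>{(i, j). i + j = Suc N}. g i j)
    = (\<Sum>(i, j)\<in>{(i, j). i + j = Suc N \<and> i > 0 \<and> j > 0}. g i j) + (g 0 (Suc N) + g (Suc N) 0)"
proof -
  have "{(i, j). i + j = Suc N} = {(i, j). i + j = Suc N \<and> i > 0 \<and> j > 0} \<union> {(0, Suc N), (Suc N, 0)}"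
    by auto
  moreover have "finite {(i, j). i + j = Suc N \<and> i > 0 \<and> j > 0}"
    by (rule finite_subset[OF _ finite_pairs[of "Suc N" "Suc N"]]) auto
  ultimately show ?thesis
    by (simp add: ac_simps)
qed

lemma sum_triples_Suc:
  fixes g :: "nat \<Rightarrow> nat \<Rightarrow> nat \<Rightarrow> 'a::comm_monoid_add"
  shows "(\<Sum>(i, j, k)\<in>{(i, j, k). i + j + k = Suc N}. g i j k)
    = (\<Sum>(i, j, k)\<in>{(i, j, k). i \<le> N \<and> j \<le> N \<and> k \<le> N \<and> i + j + k = Suc N}. g i j k)
      + (g (Suc N) 0 0 + (g 0 (Suc N) 0 + g 0 0 (Suc N)))"
proof -
  have "{(i, j, k). i + j + k = Suc N} = {(i, j, k). i \<le> N \<and> j \<le> N \<and> k \<le> N \<and> i + j + k = Suc N}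
    \<union> {(Suc N, 0, 0), (0, Suc N, 0), (0, 0, Suc N)}"
    by auto
  moreover have "finite {(i, j, k). i \<le> N \<and> j \<le> N \<and> k \<le> N \<and> i + j + k = Suc N}"
    by (rule finite_subset[OF _ finite_triples[of "Suc N" "Suc N"]]) auto
  ultimately show ?thesis
    by (simp add: ac_simps)
qed

lemma all_le_Suc: "(\<forall>n\<le>Suc N. P n) \<longleftrightarrow> (\<forall>n\<le>N. P n) \<and> P (Suc N :: nat)"
  by (auto simp: le_Suc_eq)

text \<open>Through order \<open>N\<close> the equations do not involve \<open>G\<close>. At order
  \<open>Suc N\<close> the old terms sum to the obstruction, and the two terms with \<open>G\<close>
  contribute minus its coboundary by \<open>pre_lie_coboundary\<close>.\<close>

lemma dialgebra_laws_extend_iff: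
  assumes "additive_products N F" "additive_products (Suc N) (F(Suc N := G))"
    and laws: "dialgebra_laws (eq_mod N) (tprod N F)"
  shows "dialgebra_laws (eq_mod (Suc N)) (tprod (Suc N) (F(Suc N := G))) \<longleftrightarrow>
    (\<forall>y\<in>Y 3. \<forall>a b c. Ob_alg N F y [a, b, c]
      = coboundary (bil (F 0)) (bil (F 0)) (bil (F 0)) 2 G y [a, b, c])"
proof -
  let ?F = "F(Suc N := G)"
  have low: "(\<Sum>(i, j)\<in>{(i, j). i + j = n}. pre_lie (?F i) (?F j) y [a, b, c]) = 0"
    if "y \<in> Y 3" "n \<le> N" for y a b c n
  proof -
    have "(\<Sum>(i, j)\<in>{(i, j). i + j = n}. pre_lie (?F i) (?F j) y [a, b, c])
      = (\<Sum>(i, j)\<in>{(i, j). i + j = n}. pre_lie (F i) (F j) y [a, b, c])"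
      using that by (intro sum.cong) auto
    then show ?thesis
      using laws that unfolding additive_products.dialgebra_laws_iff[OF assms(1)] by metis
  qed
  have top: "(\<Sum>(i, j)\<in>{(i, j). i + j = Suc N}. pre_lie (?F i) (?F j) y [a, b, c])
    = Ob_alg N F y [a, b, c] - coboundary (bil (F 0)) (bil (F 0)) (bil (F 0)) 2 G y [a, b, c]"
    if "y \<in> Y 3" for y a b c
  proof -
    have "(\<Sum>(i, j)\<in>{(i, j). i + j = Suc N \<and> i > 0 \<and> j > 0}. pre_lie (?F i) (?F j) y [a, b, c])
      = Ob_alg N F y [a, b, c]"
      by (auto simp: Ob_alg_def intro!: sum.cong)
    with pre_lie_coboundary[OF that, of "F 0" G a b c] show ?thesis
      unfolding sum_pairs_Suc by simp
  qed
  show ?thesis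
    unfolding additive_products.dialgebra_laws_iff[OF assms(2)] all_le_Suc
    using low top by simp
qed

lemma multiplicative_extend_iff:
  assumes mult: "multiplicative \<Theta> N"
  shows "multiplicative (\<Theta>(Suc N := \<theta>)) (Suc N) \<longleftrightarrow>
    (\<forall>y\<in>Y 2. \<forall>a b. Ob_psi N \<Theta> y [a, b] = Fpsi \<Theta> 0 (fst \<theta> y [a, b])
      - fst (snd \<theta>) y [Fpsi \<Theta> 0 a, Fpsi \<Theta> 0 b]
      - coboundary (bil (FD \<Theta> 0)) (\<lambda>s a e. bil (FE \<Theta> 0) s (Fpsi \<Theta> 0 a) e)
        (\<lambda>s e a. bil (FE \<Theta> 0) s e (Fpsi \<Theta> 0 a)) 1 (snd (snd \<theta>)) y [a, b])"
proof -
  let ?\<Theta> = "\<Theta>(Suc N := \<theta>)"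
  have upd: "FD ?\<Theta> i = (if i = Suc N then fst \<theta> else FD \<Theta> i)"
    "FE ?\<Theta> i = (if i = Suc N then fst (snd \<theta>) else FE \<Theta> i)"
    "Fpsi ?\<Theta> i = (if i = Suc N then lin (snd (snd \<theta>)) else Fpsi \<Theta> i)" for i
    by (simp_all add: FD_def FE_def Fpsi_def)
  have low: "(\<Sum>i\<le>n. Fpsi ?\<Theta> i (bil (FD ?\<Theta> (n - i)) s a b)) =
     (\<Sum>(i, j, k) \<in> {(i, j, k). i + j + k = n}. bil (FE ?\<Theta> i) s (Fpsi ?\<Theta> j a) (Fpsi ?\<Theta> k b))"
    if "n \<le> N" for s a b n
  proof -
    have "(\<Sum>i\<le>n. Fpsi ?\<Theta> i (bil (FD ?\<Theta> (n - i)) s a b)) = (\<Sum>i\<le>n. Fpsi \<Theta> i (bil (FD \<Theta> (n - i)) s a b))"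
      using that by (intro sum.cong) (auto simp: upd)
    also have "\<dots> = (\<Sum>(i, j, k) \<in> {(i, j, k). i + j + k = n}. bil (FE \<Theta> i) s (Fpsi \<Theta> j a) (Fpsi \<Theta> k b))"
      using mult that by (simp add: multiplicative_def)
    also have "\<dots> = (\<Sum>(i, j, k) \<in> {(i, j, k). i + j + k = n}. bil (FE ?\<Theta> i) s (Fpsi ?\<Theta> j a) (Fpsi ?\<Theta> k b))"
      using that by (intro sum.cong) (auto simp: upd)
    finally show ?thesis .
  qed
  have left: "(\<Sum>i\<le>Suc N. Fpsi ?\<Theta> i (bil (FD ?\<Theta> (Suc N - i)) s a b)) =
    Fpsi \<Theta> 0 (bil (fst \<theta>) s a b) + (\<Sum>i = 1..N. Fpsi \<Theta> i (bil (FD \<Theta> (Suc N - i)) s a b))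
      + lin (snd (snd \<theta>)) (bil (FD \<Theta> 0) s a b)" for s a b
  proof -
    \<comment> \<open>The ends \<open>i = 0\<close> and \<open>i = Suc N\<close> carry the new
      coefficients; the middle is the sum subtracted in \<open>Ob_bil\<close>.\<close>
    have "{..Suc N} = insert 0 (insert (Suc N) {1..N})" by auto
    moreover have "(\<Sum>i = 1..N. Fpsi ?\<Theta> i (bil (FD ?\<Theta> (Suc N - i)) s a b))
      = (\<Sum>i = 1..N. Fpsi \<Theta> i (bil (FD \<Theta> (Suc N - i)) s a b))"
      by (intro sum.cong) (auto simp: upd)
    ultimately show ?thesis by (simp add: upd ac_simps)
  qed
  have right: "(\<Sum>(i, j, k) \<in> {(i, j, k). i + j + k = Suc N}. bil (FE ?\<Theta> i) s (Fpsi ?\<Theta> j a) (Fpsi ?\<Theta> k b)) =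
    (\<Sum>(i, j, k)\<in>{(i, j, k). i \<le> N \<and> j \<le> N \<and> k \<le> N \<and> i + j + k = Suc N}.
      bil (FE \<Theta> i) s (Fpsi \<Theta> j a) (Fpsi \<Theta> k b))
    + (bil (fst (snd \<theta>)) s (Fpsi \<Theta> 0 a) (Fpsi \<Theta> 0 b)
      + (bil (FE \<Theta> 0) s (lin (snd (snd \<theta>)) a) (Fpsi \<Theta> 0 b)
        + bil (FE \<Theta> 0) s (Fpsi \<Theta> 0 a) (lin (snd (snd \<theta>)) b)))" for s a b
  proof -
    have "(\<Sum>(i, j, k)\<in>{(i, j, k). i \<le> N \<and> j \<le> N \<and> k \<le> N \<and> i + j + k = Suc N}.
        bil (FE ?\<Theta> i) s (Fpsi ?\<Theta> j a) (Fpsi ?\<Theta> k b))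
      = (\<Sum>(i, j, k)\<in>{(i, j, k). i \<le> N \<and> j \<le> N \<and> k \<le> N \<and> i + j + k = Suc N}.
        bil (FE \<Theta> i) s (Fpsi \<Theta> j a) (Fpsi \<Theta> k b))"
      by (intro sum.cong) (auto simp: upd)
    then show ?thesis unfolding sum_triples_Suc by (simp add: upd)
  qed
  \<comment> \<open>All three faces of a 2-tree are \<open>t1\<close>, and all three of its
    \<open>circ\<close> values equal the side it encodes.\<close>
  have cob: "coboundary p la ra 1 f (tree_of s) [a, b] = la s a (lin f b) - lin f (p s a b) + ra s (lin f a) b"
    for p :: "side \<Rightarrow> 'a \<Rightarrow> 'a \<Rightarrow> 'a" and la ra s a b and f :: "('a, 'b) cochain"
    by (subst coboundary_1, simp) (cases s; simp add: lin_def tree_defs circ_def)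
  have "multiplicative ?\<Theta> (Suc N) \<longleftrightarrow> (\<forall>s a b. Ob_bil N \<Theta> s a b = Fpsi \<Theta> 0 (bil (fst \<theta>) s a b)
      - bil (fst (snd \<theta>)) s (Fpsi \<Theta> 0 a) (Fpsi \<Theta> 0 b)
      - (bil (FE \<Theta> 0) s (Fpsi \<Theta> 0 a) (lin (snd (snd \<theta>)) b) - lin (snd (snd \<theta>)) (bil (FD \<Theta> 0) s a b)
        + bil (FE \<Theta> 0) s (lin (snd (snd \<theta>)) a) (Fpsi \<Theta> 0 b)))"
    unfolding multiplicative_def all_le_Suc left right Ob_bil_def
    by (simp add: low, intro arg_cong[where f = All] ext, auto simp: algebra_simps)
  also have "\<dots> \<longleftrightarrow> (\<forall>s a b. Ob_psi N \<Theta> (tree_of s) [a, b] = Fpsi \<Theta> 0 (fst \<theta> (tree_of s) [a, b])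
      - fst (snd \<theta>) (tree_of s) [Fpsi \<Theta> 0 a, Fpsi \<Theta> 0 b]
      - coboundary (bil (FD \<Theta> 0)) (\<lambda>s a e. bil (FE \<Theta> 0) s (Fpsi \<Theta> 0 a) e)
        (\<lambda>s e a. bil (FE \<Theta> 0) s e (Fpsi \<Theta> 0 a)) 1 (snd (snd \<theta>)) (tree_of s) [a, b])"
    by (simp only: cob Ob_psi_eq[OF tree_of_in_Y] side_of_tree_of bil_def)
  finally show ?thesis
    using tree_of_in_Y tree_of_side_of by metis
qed

lemma additive_products_CY:
  assumes "\<And>i. i \<le> N \<Longrightarrow> F i \<in> CY sD sD 2"
  shows "additive_products N F"
  unfolding additive_products_def
  using linear_additive[OF CY_2_linear(1)[OF assms]] linear_additive[OF CY_2_linear(2)[OF assms]] by blast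

text \<open>The third component of \<open>dm\<close> has no explicit guard on its domain. It
  vanishes there because the cochains do and \<open>\<psi> 0 = 0\<close>; this upgrades equality on
  arguments to equality of functions.\<close>

lemma dm_outside:
  assumes "z \<in> CYm sD sE n" "\<psi> 0 = 0" and out: "\<not> (y \<in> Y n \<and> length xs = n)" and "0 < n"
  shows "snd (snd (dm pD pE \<psi> n z)) y xs = 0"
  using assms CY_outside[of "fst z" sD sD n y xs] CY_outside[of "fst (snd z)" sE sE n y "map \<psi> xs"]
  by (auto simp: CYm_def dm_def coboundary_def)

lemma coboundary_outside: "\<not> (y \<in> Y (n + 1) \<and> length xs = n + 1) \<Longrightarrow> coboundary p la ra n f y xs = 0"
  by (auto simp: coboundary_def)

lemma length_2: "length xs = 2 \<Longrightarrow> \<exists>a b. xs = [a, b]"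
  by (auto simp: length_Suc_conv numeral_2_eq_2)

lemma length_3: "length xs = 3 \<Longrightarrow> \<exists>a b c. xs = [a, b, c]"
  by (auto simp: length_Suc_conv numeral_3_eq_3)

lemma Ob_alg_eq_iff:
  "Ob_alg N F = coboundary p la ra 2 G \<longleftrightarrow>
    (\<forall>y\<in>Y 3. \<forall>a b c. Ob_alg N F y [a, b, c] = coboundary p la ra 2 G y [a, b, c])" (is "?L \<longleftrightarrow> ?R")
proof
  assume ?R
  show ?L
  proof (intro ext)
    fix y xs
    show "Ob_alg N F y xs = coboundary p la ra 2 G y xs"
    proof (cases "y \<in> Y 3 \<and> length xs = 3")
      case True
      then show ?thesis using \<open>?R\<close> length_3 by blast
    next
      case False
      then show ?thesis
        using coboundary_outside[of y 2 xs] by (simp add: Ob_alg_def pre_lie_outside)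
    qed
  qed
qed simp

lemma Ob_eq_dm_iff:
  assumes "\<theta> \<in> CYm sD sE 2" "\<psi> 0 = 0"
  shows "Ob N \<Theta> = dm pD pE \<psi> 2 \<theta> \<longleftrightarrow>
    Ob_alg N (FD \<Theta>) = coboundary pD pD pD 2 (fst \<theta>) \<and>
    Ob_alg N (FE \<Theta>) = coboundary pE pE pE 2 (fst (snd \<theta>)) \<and>
    (\<forall>y\<in>Y 2. \<forall>a b. Ob_psi N \<Theta> y [a, b] = \<psi> (fst \<theta> y [a, b]) - fst (snd \<theta>) y [\<psi> a, \<psi> b]
      - coboundary pD (\<lambda>s a e. pE s (\<psi> a) e) (\<lambda>s e a. pE s e (\<psi> a)) 1 (snd (snd \<theta>)) y [a, b])"
proof -
  obtain F G f where \<theta>: "\<theta> = (F, G, f)" by (cases \<theta>)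
  have "Ob_psi N \<Theta> = snd (snd (dm pD pE \<psi> 2 \<theta>)) \<longleftrightarrow>
    (\<forall>y\<in>Y 2. \<forall>a b. Ob_psi N \<Theta> y [a, b] = snd (snd (dm pD pE \<psi> 2 \<theta>)) y [a, b])" (is "?L \<longleftrightarrow> ?R")
  proof
    assume ?R
    show ?L
    proof (intro ext)
      fix y xs
      show "Ob_psi N \<Theta> y xs = snd (snd (dm pD pE \<psi> 2 \<theta>)) y xs"
      proof (cases "y \<in> Y 2 \<and> length xs = 2")
        case True
        then show ?thesis using \<open>?R\<close> length_2 by blast
      next
        case False
        then show ?thesis
          using dm_outside[of \<theta> sD sE 2 \<psi> y xs] assms by (simp add: Ob_psi_outside)
      qed
    qed
  qed simp
  then show ?thesis by (auto simp: Ob_def dm_def \<theta>)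
qed

lemma extension_iff:
  assumes deform: "deformation sD pD sE pE \<psi> N \<Theta>" and \<theta>: "\<theta> \<in> CYm sD sE 2" and \<psi>: "\<psi> 0 = 0"
  shows "extension sD pD sE pE \<psi> N \<Theta> \<theta> \<longleftrightarrow> Ob N \<Theta> = dm pD pE \<psi> 2 \<theta>"
proof -
  have CYm: "\<And>i. i \<le> N \<Longrightarrow> \<Theta> i \<in> CYm sD sE 2"
    and zero: "bil (FD \<Theta> 0) = pD" "bil (FE \<Theta> 0) = pE" "Fpsi \<Theta> 0 = \<psi>"
    and laws: "dialgebra_laws (eq_mod N) (tprod N (FD \<Theta>))" "dialgebra_laws (eq_mod N) (tprod N (FE \<Theta>))"
    and mult: "multiplicative \<Theta> N"
    using deform unfolding deformation_def multiplicative_def by blast+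
  let ?\<Theta> = "\<Theta>(Suc N := \<theta>)"
  have upd: "FD ?\<Theta> = (FD \<Theta>)(Suc N := fst \<theta>)" "FE ?\<Theta> = (FE \<Theta>)(Suc N := fst (snd \<theta>))"
    by (auto simp: FD_def FE_def Fpsi_def)
  have CYm': "?\<Theta> i \<in> CYm sD sE 2" if "i \<le> Suc N" for i
    using that CYm \<theta> by auto
  have zero': "bil (FD ?\<Theta> 0) = pD" "bil (FE ?\<Theta> 0) = pE" "Fpsi ?\<Theta> 0 = \<psi>"
    using zero by (simp_all add: FD_def FE_def Fpsi_def)
  \<comment> \<open>The cochain conditions and the initial terms carry over, since the update is at
    \<open>Suc N\<close>, which is not 0.\<close>
  have ext: "extension sD pD sE pE \<psi> N \<Theta> \<theta> \<longleftrightarrow>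
    dialgebra_laws (eq_mod (Suc N)) (tprod (Suc N) (FD ?\<Theta>)) \<and>
    dialgebra_laws (eq_mod (Suc N)) (tprod (Suc N) (FE ?\<Theta>)) \<and> multiplicative ?\<Theta> (Suc N)"
    unfolding extension_def Suc_eq_plus1[symmetric] deformation_def multiplicative_def[symmetric]
    using CYm' zero' by blast
  have D: "additive_products N (FD \<Theta>)" "additive_products (Suc N) (FD ?\<Theta>)"
    and E: "additive_products N (FE \<Theta>)" "additive_products (Suc N) (FE ?\<Theta>)"
    by (rule additive_products_CY, (rule CYm_parts)?, erule CYm CYm')+
  have "dialgebra_laws (eq_mod (Suc N)) (tprod (Suc N) (FD ?\<Theta>)) \<longleftrightarrow>
      Ob_alg N (FD \<Theta>) = coboundary pD pD pD 2 (fst \<theta>)"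
    using dialgebra_laws_extend_iff[OF D(1) D(2)[unfolded upd] laws(1)]
    unfolding Ob_alg_eq_iff upd zero by simp
  moreover have "dialgebra_laws (eq_mod (Suc N)) (tprod (Suc N) (FE ?\<Theta>)) \<longleftrightarrow>
      Ob_alg N (FE \<Theta>) = coboundary pE pE pE 2 (fst (snd \<theta>))"
    using dialgebra_laws_extend_iff[OF E(1) E(2)[unfolded upd] laws(2)]
    unfolding Ob_alg_eq_iff upd zero by simp
  moreover have "multiplicative ?\<Theta> (Suc N) \<longleftrightarrow> (\<forall>y\<in>Y 2. \<forall>a b. Ob_psi N \<Theta> y [a, b]
      = \<psi> (fst \<theta> y [a, b]) - fst (snd \<theta>) y [\<psi> a, \<psi> b]
      - coboundary pD (\<lambda>s a e. pE s (\<psi> a) e) (\<lambda>s e a. pE s e (\<psi> a)) 1 (snd (snd \<theta>)) y [a, b])"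
    using multiplicative_extend_iff[OF mult, of \<theta>] unfolding zero by simp
  ultimately show ?thesis
    unfolding ext Ob_eq_dm_iff[where \<psi> = \<psi>, OF \<theta> \<psi>] by blast
qed

section \<open>The obstruction is a cocycle\<close>

lemma Ob_cocycle:
  assumes vs: "vector_space sD" "vector_space sE" and deform: "deformation sD pD sE pE \<psi> N \<Theta>"
  shows "Ob N \<Theta> \<in> cocycles sD pD sE pE \<psi> 3"
proof -
  have CYm: "\<And>i. i \<le> N \<Longrightarrow> \<Theta> i \<in> CYm sD sE 2"
    and zero: "bil (FD \<Theta> 0) = pD" "bil (FE \<Theta> 0) = pE" "Fpsi \<Theta> 0 = \<psi>"
    and laws: "dialgebra_laws (eq_mod N) (tprod N (FD \<Theta>))" "dialgebra_laws (eq_mod N) (tprod N (FE \<Theta>))"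
    and mult: "multiplicative \<Theta> N"
    using deform unfolding deformation_def multiplicative_def by blast+
  have D: "additive_products N (FD \<Theta>)" and E: "additive_products N (FE \<Theta>)"
    by (rule additive_products_CY, erule CYm_parts[OF CYm])+
  interpret additive_morphism N \<Theta>
    using D E linear_additive[OF CYm_parts(3)[OF CYm]]
    by (simp add: additive_morphism_def additive_morphism_axioms_def)
  have in_CYm: "Ob N \<Theta> \<in> CYm sD sE 3"
    using Ob_alg_in_CY[OF vs(1), of N "FD \<Theta>"] Ob_alg_in_CY[OF vs(2), of N "FE \<Theta>"]
      Ob_psi_in_CY[OF vs, of N \<Theta>] CYm_parts[OF CYm] CYm by (auto simp: CYm_def Ob_def)
  have "\<psi> 0 = 0"
    using additive.zero[OF add_psi[of 0]] zero by simp
  have "snd (snd (dm pD pE \<psi> 3 (Ob N \<Theta>))) y xs = 0" for y xs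
  proof (cases "y \<in> Y 3 \<and> length xs = 3")
    case True
    then obtain a b c where "xs = [a, b, c]" using length_3 by blast
    then show ?thesis
      using Ob_psi_cocycle[OF laws mult, of y a b c] True unfolding zero by (simp add: dm_def Ob_def)
  next
    case False
    then show ?thesis
      using dm_outside[OF in_CYm, of \<psi> y xs] \<open>\<psi> 0 = 0\<close> by simp
  qed
  moreover have "fst (dm pD pE \<psi> 3 (Ob N \<Theta>)) = 0"
    using D.coboundary_Ob_alg[OF laws(1)] unfolding zero by (simp add: dm_def Ob_def)
  moreover have "fst (snd (dm pD pE \<psi> 3 (Ob N \<Theta>))) = 0"
    using E.coboundary_Ob_alg[OF laws(2)] unfolding zero by (simp add: dm_def Ob_def)
  ultimately have "dm pD pE \<psi> 3 (Ob N \<Theta>) = 0"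
    by (simp add: prod_eq_iff fun_eq_iff)
  with in_CYm show ?thesis by (simp add: cocycles_def)
qed

text \<open>Additivity of \<open>dm\<close> makes the coboundaries a subgroup, so that classes
  behave as cosets inside the cocycles.\<close>

lemma HY_class_eq_zero_iff:
  assumes vs: "vector_space sD" "vector_space sE" and add: "\<And>n. additive (dm pD pE \<psi> n)"
    and z: "z \<in> cocycles sD pD sE pE \<psi> n"
  shows "HY_class sD pD sE pE \<psi> n z = HY_class sD pD sE pE \<psi> n 0 \<longleftrightarrow> z \<in> coboundaries sD pD sE pE \<psi> n"
proof -
  let ?B = "coboundaries sD pD sE pE \<psi> n"
  have CYm_0: "0 \<in> CYm sD sE m" for m
    using vs by (simp add: CYm_def zero_prod_def CY_zero)
  have CYm_diff: "u - v \<in> CYm sD sE m" if "u \<in> CYm sD sE m" "v \<in> CYm sD sE m" for u v m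
    using that by (auto simp: CYm_def CY_diff)
  have B_0: "0 \<in> ?B"
    using CYm_0 additive.zero[OF add] by (force simp: coboundaries_def)
  have B_diff: "u - v \<in> ?B" if "u \<in> ?B" "v \<in> ?B" for u v
    using that CYm_diff additive.diff[OF add, symmetric] by (auto simp: coboundaries_def split: if_splits)
  have "0 \<in> cocycles sD pD sE pE \<psi> n"
    using CYm_0 additive.zero[OF add] by (simp add: cocycles_def)
  then have members: "w \<in> HY_class sD pD sE pE \<psi> n z \<longleftrightarrow> w \<in> cocycles sD pD sE pE \<psi> n \<and> z - w \<in> ?B"
    "w \<in> HY_class sD pD sE pE \<psi> n 0 \<longleftrightarrow> w \<in> cocycles sD pD sE pE \<psi> n \<and> 0 - w \<in> ?B" for w
    using z by (auto simp: HY_class_def cohomologous_def)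
  show ?thesis
  proof
    assume "HY_class sD pD sE pE \<psi> n z = HY_class sD pD sE pE \<psi> n 0"
    \<comment> \<open>\<open>z\<close> lies in its own class because 0 is a coboundary, hence also
      in the class of 0.\<close>
    then have "0 - z \<in> ?B" using members[of z] z B_0 by auto
    then show "z \<in> ?B" using B_diff[OF B_0] by fastforce
  next
    assume "z \<in> ?B"
    have "z - w \<in> ?B \<longleftrightarrow> 0 - w \<in> ?B" for w
    proof
      assume "z - w \<in> ?B"
      from B_diff[OF this \<open>z \<in> ?B\<close>] show "0 - w \<in> ?B" by simp
    next
      assume "0 - w \<in> ?B"
      from B_diff[OF this B_diff[OF B_0 \<open>z \<in> ?B\<close>]] show "z - w \<in> ?B" by simp
    qed
    then show "HY_class sD pD sE pE \<psi> n z = HY_class sD pD sE pE \<psi> n 0"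
      using members by blast
  qed
qed

theorem theorem6p3:
  fixes sD :: "'k::field \<Rightarrow> 'd::ab_group_add \<Rightarrow> 'd" and pD :: "side \<Rightarrow> 'd \<Rightarrow> 'd \<Rightarrow> 'd"
    and sE :: "'k \<Rightarrow> 'e::ab_group_add \<Rightarrow> 'e" and pE :: "side \<Rightarrow> 'e \<Rightarrow> 'e \<Rightarrow> 'e"
    and \<psi> :: "'d \<Rightarrow> 'e" and N :: nat and \<Theta> :: "nat \<Rightarrow> ('d, 'e) mcochain"
  assumes "dialgebra sD pD"
    and "dialgebra sE pE"
    and "dialgebra_hom sD pD sE pE \<psi>"
    and "0 < N"
    and "deformation sD pD sE pE \<psi> N \<Theta>"
  shows "Ob N \<Theta> \<in> cocycles sD pD sE pE \<psi> 3 \<and>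
    ((\<exists>\<theta>' \<in> CYm sD sE 2. extension sD pD sE pE \<psi> N \<Theta> \<theta>') \<longleftrightarrow>
       HY_class sD pD sE pE \<psi> 3 (Ob N \<Theta>) = HY_class sD pD sE pE \<psi> 3 0) \<and>
    (\<forall>\<theta>' \<in> CYm sD sE 2.
       extension sD pD sE pE \<psi> N \<Theta> \<theta>' \<longleftrightarrow> Ob N \<Theta> = dm pD pE \<psi> 2 \<theta>')"
proof (intro conjI ballI)
  have vs: "vector_space sD" "vector_space sE" and psi: "additive \<psi>"
    using assms(1-3) linear_additive by (auto simp: dialgebra_def dialgebra_hom_def)
  have add: "additive (dm pD pE \<psi> n)" for n
    using assms(1,2) psi unfolding dialgebra_def by (intro additive_dm) (blast intro: linear_additive)+
  note ext = extension_iff[OF assms(5) _ additive.zero[OF psi]]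
  show cocycle: "Ob N \<Theta> \<in> cocycles sD pD sE pE \<psi> 3"
    using Ob_cocycle[OF vs assms(5)] .
  show "(\<exists>\<theta>' \<in> CYm sD sE 2. extension sD pD sE pE \<psi> N \<Theta> \<theta>') \<longleftrightarrow>
       HY_class sD pD sE pE \<psi> 3 (Ob N \<Theta>) = HY_class sD pD sE pE \<psi> 3 0"
    \<comment> \<open>The coboundaries in degree 3 are the values of \<open>dm\<close> on
      \<open>CYm sD sE 2\<close>, so a preimage of the obstruction is precisely the coefficient of
      an extension.\<close>
    unfolding HY_class_eq_zero_iff[OF vs add cocycle] using ext by (auto simp: coboundaries_def)
  show "extension sD pD sE pE \<psi> N \<Theta> \<theta>' \<longleftrightarrow> Ob N \<Theta> = dm pD pE \<psi> 2 \<theta>'" if "\<theta>' \<in> CYm sD sE 2" for \<theta>'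
    using ext[OF that] .
qed

end
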